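(* Let $H$ and $K$ be separable Hilbert spaces, let $V=\{(V_i,v_i)\}_{i\in I}$ and $W=\{(W_j,w_j)\}_{j\in J}$ be fusion frames for $H$ and $K$, respectively, and let $S_{V\otimes W}$ be the fusion frame operator of $V\otimes W=\{(V_i\otimes W_j,v_iw_j)\}_{(i,j)\in I\times J}$. Then for all $f\otimes g\in H\otimes K$, $$f\otimes g=\sum_{i,j}v_i^2w_j^2\,P_{S_{V\otimes W}^{-1}(V_i\otimes W_j)}\,S_{V\otimes W}^{-1}\,P_{V_i\otimes W_j}(f\otimes g),$$ so that the canonical dual frame $\{(S_{V\otimes W}^{-1}(V_i\otimes W_j),v_iw_j)\}_{(i,j)\in I\times J}$ is an alternative dual of the fusion frame $V\otimes W$ for $H\otimes K$.
   Context: $H\otimes K$ is the Hilbert space tensor product, with $\langle f\otimes g,f'\otimes g'\rangle=\langle f,f'\rangle\langle g,g'\rangle$; $V_i\otimes W_j$ is the closed subspace of $H\otimes K$ given by the tensor product of the closed subspaces $V_i\subset H$ and $W_j\subset K$. $P_X$ denotes the orthogonal projection onto a closed subspace $X$. "For all $f\otimes g\in H\otimes K$" means for all $f\in H$ and $g\in K$. A family $V=\{(V_i,v_i)\}_{i\in I}$ of closed subspaces of $H$ with weights $v_i>0$ is a fusion frame for $H$ if there exist $0<A\le B<\infty$ such that $A\|f\|^2\le\sum_{i\in I}v_i^2\|P_{V_i}f\|^2\le B\|f\|^2$ for all $f\in H$ (similarly for $K$). A family $\{(X_{ij},u_{ij})\}_{i,j}$ of closed subspaces of $H\otimes K$ with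 positive weights is a fusion frame for $H\otimes K$ if there exist $0<A\le B<\infty$ such that $A\|f\otimes g\|^2\le\sum_{i,j}u_{ij}^2\|P_{X_{ij}}(f\otimes g)\|^2\le B\|f\otimes g\|^2$ for all $f\otimes g\in H\otimes K$; if only the upper inequality is required it is a fusion Bessel sequence. When $V$ and $W$ are fusion frames, $V\otimes W$ is a fusion frame for $H\otimes K$, and its fusion frame operator is the bounded invertible linear operator $S_{V\otimes W}$ on $H\otimes K$ with $S_{V\otimes W}(f\otimes g)=\sum_{i,j}v_i^2w_j^2P_{V_i\otimes W_j}(f\otimes g)$. A fusion Bessel sequence $\{(X'_{ij},u'_{ij})\}_{i,j}$ in $H\otimes K$ is an alternative dual of $V\otimes W$ if for all $f\otimes g\in H\otimes K$, $f\otimes g=\sum_{i,j}v_iw_ju'_{ij}\,P_{X'_{ij}}S_{V\otimes W}^{-1}P_{V_i\otimes W_j}(f\otimes g)$. *)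

theory Defs
  imports "HOL-Analysis.Analysis"
begin

text \<open>
  The scalar field is the real or the complex numbers. By the Gelfand-Mazur theorem these are the
  only instances of the class below; the last axiom forces the conjugation to be the identity
  on the reals and the usual conjugation on the complex numbers.
\<close>

class real_or_complex = real_normed_field +
  fixes conjg :: "'a \<Rightarrow> 'a"
  assumes conjg_add: "conjg (x + y) = conjg x + conjg y"
    and conjg_mult: "conjg (x * y) = conjg x * conjg y"
    and mult_conjg: "x * conjg x = ((norm x)\<^sup>2) *\<^sub>R 1"

instantiation real :: real_or_complex
begin
definition conjg_real_def: "conjg (x :: real) = x"
instance by standard (auto simp: conjg_real_def power2_eq_square)
end

instantiation complex :: real_or_complex
begin
definition conjg_complex_def: "conjg (x :: complex) = cnj x"
instance by standard (auto simp: conjg_complex_def scaleR_conv_of_real simp flip: complex_norm_square)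
end

text \<open>Completeness and the topology come from the class \<^class>\<open>banach\<close>; the inner product
  is linear in its first argument and induces the norm of the type.\<close>

locale hilbert_space = vector_space sc
  for sc :: "'k::real_or_complex \<Rightarrow> 'a::banach \<Rightarrow> 'a" +
  fixes ip :: "'a \<Rightarrow> 'a \<Rightarrow> 'k"
  assumes scale_of_real: "sc (of_real r) x = r *\<^sub>R x"
    and ip_add_left: "ip (x + y) z = ip x z + ip y z"
    and ip_scale_left: "ip (sc c x) z = c * ip x z"
    and ip_commute: "ip y x = conjg (ip x y)"
    and ip_self: "ip x x = of_real ((norm x)\<^sup>2)"

definition closed_subspace :: "('k::field \<Rightarrow> 'a::real_normed_vector \<Rightarrow> 'a) \<Rightarrow> 'a set \<Rightarrow> bool" where
  "closed_subspace sc X \<longleftrightarrow> module.subspace sc X \<and> closed X"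

definition orth_proj ::
  "('a::real_normed_vector \<Rightarrow> 'a \<Rightarrow> 'k::real_or_complex) \<Rightarrow> 'a set \<Rightarrow> 'a \<Rightarrow> 'a" where
  "orth_proj ip X x = (THE p. p \<in> X \<and> (\<forall>y\<in>X. ip (x - p) y = 0))"

definition bounded_operator ::
  "('k::field \<Rightarrow> 'a::real_normed_vector \<Rightarrow> 'a) \<Rightarrow> ('a \<Rightarrow> 'a) \<Rightarrow> bool" where
  "bounded_operator sc T \<longleftrightarrow>
     Vector_Spaces.linear sc sc T \<and> (\<exists>C. \<forall>x. norm (T x) \<le> C * norm x)"

text \<open>In the definitions below \<open>summable_on\<close> is needed because \<^const>\<open>infsum\<close> is \<open>0\<close> on
  divergent families.\<close>

definition fusion_frame ::
  "('k::real_or_complex \<Rightarrow> 'h::banach \<Rightarrow> 'h) \<Rightarrow> ('h \<Rightarrow> 'h \<Rightarrow> 'k)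
     \<Rightarrow> 'i set \<Rightarrow> ('i \<Rightarrow> 'h set) \<Rightarrow> ('i \<Rightarrow> real) \<Rightarrow> bool" where
  "fusion_frame sc ip I V v \<longleftrightarrow>
     (\<forall>i\<in>I. closed_subspace sc (V i) \<and> 0 < v i) \<and>
     (\<exists>A B. 0 < A \<and> A \<le> B \<and>
        (\<forall>f. (\<lambda>i. (v i)\<^sup>2 * (norm (orth_proj ip (V i) f))\<^sup>2) summable_on I \<and>
             A * (norm f)\<^sup>2 \<le> (\<Sum>\<^sub>\<infinity>i\<in>I. (v i)\<^sup>2 * (norm (orth_proj ip (V i) f))\<^sup>2) \<and>
             (\<Sum>\<^sub>\<infinity>i\<in>I. (v i)\<^sup>2 * (norm (orth_proj ip (V i) f))\<^sup>2) \<le> B * (norm f)\<^sup>2))"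

text \<open>A Hilbert space tensor product of \<open>H\<close> and \<open>K\<close>: a Hilbert space with a bilinear map
  from \<open>H \<times> K\<close> that multiplies inner products and whose range is total. These properties
  determine it up to a unique unitary that respects elementary tensors.\<close>

locale hilbert_tensor_product =
  H: hilbert_space sH ipH + K: hilbert_space sK ipK + T: hilbert_space sT ipT
  for sH :: "'k::real_or_complex \<Rightarrow> 'h::banach \<Rightarrow> 'h" and ipH
    and sK :: "'k \<Rightarrow> 'g::banach \<Rightarrow> 'g" and ipK
    and sT :: "'k \<Rightarrow> 't::banach \<Rightarrow> 't" and ipT +
  fixes tens :: "'h \<Rightarrow> 'g \<Rightarrow> 't"
  assumes tens_add_left: "tens (f + f') g = tens f g + tens f' g"
    and tens_add_right: "tens f (g + g') = tens f g + tens f g'"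
    and tens_scale_left: "tens (sH c f) g = sT c (tens f g)"
    and tens_scale_right: "tens f (sK c g) = sT c (tens f g)"
    and ip_tens: "ipT (tens f g) (tens f' g') = ipH f f' * ipK g g'"
    and tens_total: "closure (T.span {tens f g |f g. True}) = UNIV"

definition tensor_subspace ::
  "('k::field \<Rightarrow> 't::real_normed_vector \<Rightarrow> 't) \<Rightarrow> ('h \<Rightarrow> 'g \<Rightarrow> 't)
     \<Rightarrow> 'h set \<Rightarrow> 'g set \<Rightarrow> 't set" where
  "tensor_subspace sT tens X Y = closure (module.span sT {tens f g |f g. f \<in> X \<and> g \<in> Y})"

text \<open>For the tensor product the inequalities range over elementary tensors only.\<close>

definition tensor_fusion_frame ::
  "('k::real_or_complex \<Rightarrow> 't::banach \<Rightarrow> 't) \<Rightarrow> ('t \<Rightarrow> 't \<Rightarrow> 'k) \<Rightarrow> ('h \<Rightarrow> 'g \<Rightarrow> 't)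
     \<Rightarrow> 'n set \<Rightarrow> ('n \<Rightarrow> 't set) \<Rightarrow> ('n \<Rightarrow> real) \<Rightarrow> bool" where
  "tensor_fusion_frame sT ipT tens N X u \<longleftrightarrow>
     (\<forall>n\<in>N. closed_subspace sT (X n) \<and> 0 < u n) \<and>
     (\<exists>A B. 0 < A \<and> A \<le> B \<and>
        (\<forall>f g. (\<lambda>n. (u n)\<^sup>2 * (norm (orth_proj ipT (X n) (tens f g)))\<^sup>2) summable_on N \<and>
          A * (norm (tens f g))\<^sup>2
            \<le> (\<Sum>\<^sub>\<infinity>n\<in>N. (u n)\<^sup>2 * (norm (orth_proj ipT (X n) (tens f g)))\<^sup>2) \<and>
          (\<Sum>\<^sub>\<infinity>n\<in>N. (u n)\<^sup>2 * (norm (orth_proj ipT (X n) (tens f g)))\<^sup>2)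
            \<le> B * (norm (tens f g))\<^sup>2))"

definition tensor_fusion_bessel ::
  "('k::real_or_complex \<Rightarrow> 't::banach \<Rightarrow> 't) \<Rightarrow> ('t \<Rightarrow> 't \<Rightarrow> 'k) \<Rightarrow> ('h \<Rightarrow> 'g \<Rightarrow> 't)
     \<Rightarrow> 'n set \<Rightarrow> ('n \<Rightarrow> 't set) \<Rightarrow> ('n \<Rightarrow> real) \<Rightarrow> bool" where
  "tensor_fusion_bessel sT ipT tens N X u \<longleftrightarrow>
     (\<forall>n\<in>N. closed_subspace sT (X n) \<and> 0 < u n) \<and>
     (\<exists>B>0. \<forall>f g. (\<lambda>n. (u n)\<^sup>2 * (norm (orth_proj ipT (X n) (tens f g)))\<^sup>2) summable_on N \<and>
          (\<Sum>\<^sub>\<infinity>n\<in>N. (u n)\<^sup>2 * (norm (orth_proj ipT (X n) (tens f g)))\<^sup>2)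
            \<le> B * (norm (tens f g))\<^sup>2)"

definition tensor_frame_operator ::
  "('k::real_or_complex \<Rightarrow> 't::banach \<Rightarrow> 't) \<Rightarrow> ('t \<Rightarrow> 't \<Rightarrow> 'k) \<Rightarrow> ('h \<Rightarrow> 'g \<Rightarrow> 't)
     \<Rightarrow> 'i set \<Rightarrow> ('i \<Rightarrow> 'h set) \<Rightarrow> ('i \<Rightarrow> real)
     \<Rightarrow> 'j set \<Rightarrow> ('j \<Rightarrow> 'g set) \<Rightarrow> ('j \<Rightarrow> real) \<Rightarrow> 't \<Rightarrow> 't" where
  "tensor_frame_operator sT ipT tens I V v J W w =
     (THE S. bounded_operator sT S \<and> bij S \<and>
        (\<forall>f g. ((\<lambda>(i, j). ((v i)\<^sup>2 * (w j)\<^sup>2) *\<^sub>R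
                   orth_proj ipT (tensor_subspace sT tens (V i) (W j)) (tens f g))
                has_sum S (tens f g)) (I \<times> J)))"

definition tensor_alternative_dual ::
  "('k::real_or_complex \<Rightarrow> 't::banach \<Rightarrow> 't) \<Rightarrow> ('t \<Rightarrow> 't \<Rightarrow> 'k) \<Rightarrow> ('h \<Rightarrow> 'g \<Rightarrow> 't)
     \<Rightarrow> 'i set \<Rightarrow> ('i \<Rightarrow> 'h set) \<Rightarrow> ('i \<Rightarrow> real)
     \<Rightarrow> 'j set \<Rightarrow> ('j \<Rightarrow> 'g set) \<Rightarrow> ('j \<Rightarrow> real)
     \<Rightarrow> ('i \<times> 'j \<Rightarrow> 't set) \<Rightarrow> ('i \<times> 'j \<Rightarrow> real) \<Rightarrow> bool" where
  "tensor_alternative_dual sT ipT tens I V v J W w X' u' \<longleftrightarrow>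
     tensor_fusion_bessel sT ipT tens (I \<times> J) X' u' \<and>
     (\<forall>f g. ((\<lambda>(i, j). (v i * w j * u' (i, j)) *\<^sub>R
                orth_proj ipT (X' (i, j))
                  (inv (tensor_frame_operator sT ipT tens I V v J W w)
                    (orth_proj ipT (tensor_subspace sT tens (V i) (W j)) (tens f g))))
             has_sum tens f g) (I \<times> J))"

end

theory Submission
  imports Defs
begin

text \<open>
  The subspaces \<open>V\<^sub>i \<otimes> W\<^sub>j\<close> satisfy the frame inequalities on all of \<open>H \<otimes> K\<close>, not only on elementary
  tensors: a finite sum of elementary tensors can be written as \<open>\<Sum>\<^sub>k f\<^sub>k \<otimes> e\<^sub>k\<close> with orthogonal \<open>e\<^sub>k\<close>,
  so the inequalities for \<open>V\<^sub>i \<otimes> K\<close> follow from those for \<open>V\<^sub>i\<close> by Pythagoras and density; the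
  same holds for \<open>H \<otimes> W\<^sub>j\<close>, and the projection onto \<open>V\<^sub>i \<otimes> W\<^sub>j\<close> is the composition of the two
  projections. Hence the frame series converges unconditionally to a bounded, self-adjoint
  operator that is bounded below, which is the frame operator \<open>S\<close>. Since \<open>S\<^sup>-\<^sup>1\<close> maps
  \<open>V\<^sub>i \<otimes> W\<^sub>j\<close> into the range of the outer projection, that projection acts trivially and the
  reconstruction formula is \<open>S\<^sup>-\<^sup>1 S = 1\<close>.
\<close>

section \<open>Hilbert spaces\<close>

lemma norm_conjg: "norm (conjg (x::'a::real_or_complex)) = norm x"
proof (cases "x = 0")
  case True
  have "conjg 0 + conjg 0 = conjg (0::'a)"
    by (metis add_0 conjg_add)
  then show ?thesis using True by simp
next
  case False
  have "norm x * norm (conjg x) = norm x * norm x"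
    by (metis mult_conjg norm_mult norm_scaleR norm_one mult_1_right abs_norm_cancel abs_power2 power2_eq_square)
  then show ?thesis using False by simp
qed

lemma conjg_0 [simp]: "conjg 0 = (0::'a::real_or_complex)"
  using norm_conjg[of "0::'a"] by simp

text \<open>For nonzero \<open>r\<close>, the product of \<open>of_real r\<close> with its conjugate
  is \<open>r * r\<close>, and one factor cancels.\<close>

lemma conjg_of_real: "conjg (of_real r) = (of_real r :: 'a::real_or_complex)"
proof (cases "r = 0")
  case False
  have "(of_real r :: 'a) * conjg (of_real r) = of_real r * of_real r"
    by (simp add: mult_conjg of_real_def power2_eq_square)
  then show ?thesis using False by simp
qed simp

text \<open>The real part of the inner product, obtained from the norm by polarisation, so that the
  Cauchy--Schwarz inequality is just the triangle inequality.\<close>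

definition real_ip :: "'a::real_normed_vector \<Rightarrow> 'a \<Rightarrow> real" where
  "real_ip x y = ((norm (x + y))\<^sup>2 - (norm x)\<^sup>2 - (norm y)\<^sup>2) / 2"

lemma real_ip_commute: "real_ip x y = real_ip y x"
  by (simp add: real_ip_def add.commute)

lemma real_ip_le: "real_ip x y \<le> norm x * norm y"
proof -
  have "(norm (x + y))\<^sup>2 \<le> (norm x + norm y)\<^sup>2"
    by (simp add: norm_triangle_ineq power_mono)
  then show ?thesis by (simp add: real_ip_def power2_sum)
qed

lemma norm_add_sq: "(norm (x + y))\<^sup>2 = (norm x)\<^sup>2 + (norm y)\<^sup>2 + 2 * real_ip x y"
  by (simp add: real_ip_def field_simps)

lemma real_ip_self: "real_ip x x = (norm x)\<^sup>2"
  by (simp add: real_ip_def flip: scaleR_2)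

context hilbert_space
begin

section \<open>Inner product rules and the Cauchy-Schwarz inequality\<close>

lemma ip_add_right: "ip x (y + z) = ip x y + ip x z"
  by (metis ip_commute ip_add_left conjg_add)

lemma ip_scale_right: "ip x (sc c y) = conjg c * ip x y"
  by (metis ip_commute ip_scale_left conjg_mult)

text \<open>Polarisation links the norm-defined \<open>real_ip\<close> to \<open>ip\<close>. As
  \<open>of_real\<close> is injective, linearity of \<open>real_ip\<close> can be read off from that
  of \<open>ip\<close>.\<close>

lemma of_real_real_ip: "of_real (2 * real_ip x y) = ip x y + ip y x"
proof -
  have "ip (x + y) (x + y) = ip x x + ip y y + (ip x y + ip y x)"
    by (simp add: ip_add_left ip_add_right algebra_simps)
  then show ?thesis
    by (simp add: real_ip_def ip_self)
qed

lemma ip_scaleR_left: "ip (r *\<^sub>R x) y = of_real r * ip x y"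
  by (metis ip_scale_left scale_of_real)

lemma ip_scaleR_right: "ip x (r *\<^sub>R y) = of_real r * ip x y"
  by (metis ip_scale_right scale_of_real conjg_of_real)

lemma real_ip_add_left: "real_ip (x + y :: 'a) z = real_ip x z + real_ip y z"
proof -
  have "(of_real (2 * real_ip (x + y) z) :: 'k) = of_real (2 * (real_ip x z + real_ip y z))"
    unfolding distrib_left of_real_add of_real_real_ip
    by (simp only: ip_add_left ip_add_right ac_simps)
  then show ?thesis unfolding of_real_eq_iff mult_cancel_left by simp
qed

lemma real_ip_scaleR_left: "real_ip (r *\<^sub>R x :: 'a) y = r * real_ip x y"
proof -
  have "(of_real (2 * real_ip (r *\<^sub>R x) y) :: 'k) = of_real r * of_real (2 * real_ip x y)"
    unfolding of_real_real_ip by (simp only: ip_scaleR_left ip_scaleR_right distrib_left)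
  then have "(of_real (2 * real_ip (r *\<^sub>R x) y) :: 'k) = of_real (2 * (r * real_ip x y))"
    by (simp only: of_real_mult ac_simps)
  then show ?thesis by (simp only: of_real_eq_iff)
qed

lemma abs_real_ip_le: "\<bar>real_ip (x :: 'a) y\<bar> \<le> norm x * norm y"
  using real_ip_le[of x y] real_ip_le[of "-x" y] real_ip_scaleR_left[of "-1" x y] by simp

lemma bounded_bilinear_real_ip: "bounded_bilinear (real_ip :: 'a \<Rightarrow> 'a \<Rightarrow> real)"
proof
  show "\<exists>K. \<forall>a b :: 'a. norm (real_ip a b) \<le> norm a * norm b * K"
    by (rule exI[of _ 1]) (simp add: abs_real_ip_le)
  show "real_ip a (b + b') = real_ip a b + real_ip a b'" for a b b' :: 'a
    by (metis real_ip_add_left real_ip_commute)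
  show "real_ip a (r *\<^sub>R b) = r *\<^sub>R real_ip a b" for a b :: 'a and r
    by (metis real_ip_scaleR_left real_ip_commute real_scaleR_def)
qed (simp_all add: real_ip_add_left real_ip_scaleR_left)

text \<open>The class of the vectors ties the norm to real scalars only; for a general scalar
  \<open>c\<close> the rule comes from \<open>ip_self\<close> and
  \<open>c * conjg c\<close>.\<close>

lemma norm_scale: "norm (sc c x) = norm c * norm x"
proof -
  have "(of_real ((norm (sc c x))\<^sup>2) :: 'k) = (c * conjg c) * ip x x"
    unfolding ip_self[symmetric] by (simp add: ip_scale_left ip_scale_right)
  also have "\<dots> = of_real ((norm c * norm x)\<^sup>2)"
    by (simp add: mult_conjg ip_self power_mult_distrib scaleR_conv_of_real)
  finally show ?thesis
    by (simp only: of_real_eq_iff) (simp add: power2_eq_iff_nonneg)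
qed

lemma bounded_linear_scale: "bounded_linear (sc c)"
proof
  show "\<exists>K. \<forall>x. norm (sc c x) \<le> norm x * K"
    by (rule exI[of _ "norm c"]) (simp add: norm_scale mult.commute)
  show "sc c (r *\<^sub>R x) = r *\<^sub>R sc c x" for r x
    by (metis scale_of_real scale_left_commute)
qed (simp add: scale_right_distrib)

text \<open>Scaling \<open>y\<close> by \<open>ip x y\<close> makes the inner product with
  \<open>x\<close> real and nonnegative, which carries facts about \<open>real_ip\<close> over to
  \<open>ip\<close>.\<close>

lemma real_ip_scale_ip: "real_ip x (sc (ip x y) y) = (norm (ip x y))\<^sup>2"
proof -
  have *: "ip x (sc (ip x y) y) = of_real ((norm (ip x y))\<^sup>2)"
    by (metis ip_scale_right mult_conjg mult.commute scaleR_conv_of_real mult_1_right)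
  have "(of_real (2 * real_ip x (sc (ip x y) y)) :: 'k) = of_real (2 * (norm (ip x y))\<^sup>2)"
    unfolding of_real_real_ip ip_commute[of "sc (ip x y) y"] * conjg_of_real by simp
  then show ?thesis by (simp only: of_real_eq_iff)
qed

text \<open>The real inequality is applied to \<open>x\<close> and \<open>y\<close> scaled by
  \<open>ip x y\<close>; then one factor \<open>norm (ip x y)\<close> cancels.\<close>

lemma norm_ip_le: "norm (ip x y) \<le> norm x * norm y"
proof (cases "ip x y = 0")
  case False
  have "(norm (ip x y))\<^sup>2 \<le> norm x * norm (sc (ip x y) y)"
    using real_ip_le[of x "sc (ip x y) y"] by (simp add: real_ip_scale_ip)
  then have "norm (ip x y) * norm (ip x y) \<le> norm (ip x y) * (norm x * norm y)"
    by (simp add: norm_scale power2_eq_square mult_ac)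
  then show ?thesis using False by simp
qed simp

lemma bounded_bilinear_ip: "bounded_bilinear ip"
proof
  show "\<exists>K. \<forall>a b. norm (ip a b) \<le> norm a * norm b * K"
    by (rule exI[of _ 1]) (simp add: norm_ip_le)
qed (simp_all add: ip_add_left ip_add_right ip_scaleR_left ip_scaleR_right scaleR_conv_of_real)

sublocale rip: bounded_bilinear "real_ip :: 'a \<Rightarrow> 'a \<Rightarrow> real"
  by (rule bounded_bilinear_real_ip)

sublocale ipb: bounded_bilinear ip
  by (rule bounded_bilinear_ip)

declare ipb.zero_left [simp] ipb.zero_right [simp] rip.zero_left [simp] rip.zero_right [simp]

lemma ip_eq_0_commute: "ip x y = 0 \<longleftrightarrow> ip y x = 0"
  by (metis ip_commute conjg_0)

lemma real_ip_eq_0: "ip x y = 0 \<Longrightarrow> real_ip x y = 0"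
  using of_real_real_ip[of x y] ip_eq_0_commute[of x y] by simp

lemma subspace_scaleR: "subspace X \<Longrightarrow> x \<in> X \<Longrightarrow> r *\<^sub>R x \<in> X"
  by (metis scale_of_real subspace_scale)

text \<open>A subspace contains \<open>sc (ip x y) y\<close> along with \<open>y\<close>, and real
  orthogonality to that vector says that \<open>ip x y\<close> vanishes.\<close>

lemma ip_orthogonal_iff_real_ip:
  assumes "subspace X"
  shows "(\<forall>y\<in>X. ip x y = 0) \<longleftrightarrow> (\<forall>y\<in>X. real_ip x y = 0)"
proof
  assume *: "\<forall>y\<in>X. real_ip x y = 0"
  show "\<forall>y\<in>X. ip x y = 0"
  proof
    fix y assume "y \<in> X"
    then have "real_ip x (sc (ip x y) y) = 0"
      using * subspace_scale[OF assms] by blast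
    then show "ip x y = 0" by (simp add: real_ip_scale_ip)
  qed
qed (simp add: real_ip_eq_0)

section \<open>Existence of orthogonal projections\<close>

lemma parallelogram:
  "(norm (x - y))\<^sup>2 = 2 * (norm x)\<^sup>2 + 2 * (norm y)\<^sup>2 - (norm (x + y :: 'a))\<^sup>2"
  using norm_add_sq[of x y] norm_add_sq[of x "-y"] rip.minus_right[of x y] by simp

text \<open>A sequence in \<open>X\<close> minimising the distance to \<open>x\<close> is Cauchy by
  the parallelogram law; its limit is a nearest point, and a nearest point has orthogonal
  residual.\<close>

lemma orth_proj_exists:
  assumes "closed_subspace sc X"
  shows "\<exists>p\<in>X. \<forall>y\<in>X. ip (x - p) y = 0"
proof -
  have sub: "subspace X" and clo: "closed X"
    using assms by (auto simp: closed_subspace_def)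
  define D where "D = (\<lambda>y. (norm (x - y))\<^sup>2) ` X"
  define d where "d = Inf D"
  have bdd: "bdd_below D"
    by (auto simp: D_def intro: bdd_belowI[of _ 0])
  have ne: "D \<noteq> {}"
    using subspace_0[OF sub] by (auto simp: D_def)
  have d_le: "d \<le> (norm (x - y))\<^sup>2" if "y \<in> X" for y
    unfolding d_def by (rule cInf_lower[OF _ bdd]) (use that in \<open>auto simp: D_def\<close>)
  have "\<exists>y\<in>X. (norm (x - y))\<^sup>2 < d + 1 / (Suc n)" for n
  proof -
    have "Inf D < d + 1 / (Suc n)" by (simp add: d_def)
    from cInf_lessD[OF ne this] show ?thesis by (auto simp: D_def)
  qed
  then obtain y where yX: "\<And>n. y n \<in> X" and yd: "\<And>n. (norm (x - y n))\<^sup>2 < d + 1 / (Suc n)"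
    by metis
  have gap: "(norm (y m - y n))\<^sup>2 \<le> 2 / Suc m + 2 / Suc n" for m n
  proof -
    \<comment> \<open>The midpoint of \<open>y m\<close> and \<open>y n\<close> lies in
      \<open>X\<close>, so its squared distance to \<open>x\<close> is at least \<open>d\<close>;
      this bounds the sum term of the parallelogram law from below.\<close>
    have "(1/2) *\<^sub>R (y m + y n) \<in> X"
      by (intro subspace_scaleR[OF sub] subspace_add[OF sub] yX)
    then have "d \<le> (norm (x - (1/2) *\<^sub>R (y m + y n)))\<^sup>2" by (rule d_le)
    also have "x - (1/2) *\<^sub>R (y m + y n) = (1/2) *\<^sub>R ((x - y n) + (x - y m))"
      by (simp add: algebra_simps flip: scaleR_2)
    finally have "4 * d \<le> (norm ((x - y n) + (x - y m)))\<^sup>2"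
      by (simp add: power_mult_distrib power2_eq_square)
    then show ?thesis
      using parallelogram[of "x - y n" "x - y m"] yd[of n] yd[of m] by simp
  qed
  have "Cauchy y"
  proof (rule metric_CauchyI)
    fix e :: real assume e: "0 < e"
    \<comment> \<open>Beyond \<open>N\<close>, \<open>gap\<close> bounds the squared distances by
      twice \<open>2 / (N + 1)\<close>, which has to be below the square of
      \<open>e\<close>.\<close>
    obtain N where N: "4 / e\<^sup>2 < real (Suc N)"
      by (meson reals_Archimedean2 less_SucI of_nat_less_iff less_trans lessI)
    show "\<exists>M. \<forall>m\<ge>M. \<forall>n\<ge>M. dist (y m) (y n) < e"
    proof (intro exI[of _ N] allI impI)
      fix m n assume "N \<le> m" "N \<le> n"
      then have "2 / real (Suc m) + 2 / real (Suc n) \<le> 2 / real (Suc N) + 2 / real (Suc N)"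
        by (intro add_mono divide_left_mono) auto
      also have "\<dots> < e\<^sup>2"
        using N e by (simp add: divide_less_eq less_divide_eq mult.commute del: of_nat_Suc)
      finally have "(norm (y m - y n))\<^sup>2 < e\<^sup>2"
        using gap[of m n] by simp
      then show "dist (y m) (y n) < e"
        using e by (simp add: dist_norm power_less_imp_less_base)
    qed
  qed
  then obtain p where p: "y \<longlonglongrightarrow> p"
    using Cauchy_convergent convergent_def by blast
  have pX: "p \<in> X"
    using closed_sequentially[OF clo _ p] yX by blast
  have "(\<lambda>n. (norm (x - y n))\<^sup>2) \<longlonglongrightarrow> (norm (x - p))\<^sup>2"
    by (intro tendsto_intros p)
  moreover have "(\<lambda>n. d + 1 / Suc n) \<longlonglongrightarrow> d + 0"
    by (intro tendsto_intros LIMSEQ_inverse_real_of_nat[unfolded inverse_eq_divide])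
  ultimately have p_le: "(norm (x - p))\<^sup>2 \<le> d"
    using yd by (intro LIMSEQ_le) (auto intro: less_imp_le)
  have "real_ip (x - p) z = 0" if z: "z \<in> X" for z
  proof (cases "z = 0")
    case False
    \<comment> \<open>Moving \<open>p\<close> by \<open>t *\<^sub>R z\<close>, the projection of
      \<open>x - p\<close> onto the line through \<open>z\<close>, lowers the squared distance by
      \<open>t * real_ip (x - p) z\<close>. This amount is nonnegative, so minimality forces it to
      be zero.\<close>
    define t where "t = real_ip (x - p) z / (norm z)\<^sup>2"
    have "p + t *\<^sub>R z \<in> X"
      by (intro subspace_add[OF sub] subspace_scaleR[OF sub] pX z)
    then have "(norm (x - p))\<^sup>2 \<le> (norm (x - (p + t *\<^sub>R z)))\<^sup>2"
      using d_le p_le order_trans by blast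
    also have "x - (p + t *\<^sub>R z) = (x - p) + (- t) *\<^sub>R z" by simp
    also have "(norm ((x - p) + (- t) *\<^sub>R z))\<^sup>2 = (norm (x - p))\<^sup>2 + t\<^sup>2 * (norm z)\<^sup>2 - 2 * t * real_ip (x - p) z"
      unfolding norm_add_sq rip.scaleR_right by (simp add: power_mult_distrib)
    also have "t\<^sup>2 * (norm z)\<^sup>2 = t * real_ip (x - p) z"
      using False by (simp add: t_def power2_eq_square)
    finally have "t * real_ip (x - p) z \<le> 0" by simp
    also have "t * real_ip (x - p) z = (real_ip (x - p) z)\<^sup>2 / (norm z)\<^sup>2"
      by (simp add: t_def power2_eq_square)
    finally show ?thesis
      using False by (simp add: divide_le_0_iff)
  qed simp
  then show ?thesis
    using pX ip_orthogonal_iff_real_ip[OF sub, of "x - p"] by blast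
qed

section \<open>Rules for orthogonal projections\<close>

lemma orth_proj_eqI:
  assumes "closed_subspace sc X" "p \<in> X" "\<And>y. y \<in> X \<Longrightarrow> ip (x - p) y = 0"
  shows "orth_proj ip X x = p"
  unfolding orth_proj_def
proof (rule the_equality)
  fix q assume q: "q \<in> X \<and> (\<forall>y\<in>X. ip (x - q) y = 0)"
  have "p - q \<in> X"
    using assms q by (auto simp: closed_subspace_def subspace_diff)
  then have "ip (x - q) (p - q) - ip (x - p) (p - q) = 0"
    using assms q by simp
  then have "ip (p - q) (p - q) = 0"
    by (simp flip: ipb.diff_left)
  then show "q = p" by (simp add: ip_self)
qed (use assms in auto)

lemma orth_proj_mem: "closed_subspace sc X \<Longrightarrow> orth_proj ip X x \<in> X"
  and ip_orth_proj_diff: "closed_subspace sc X \<Longrightarrow> y \<in> X \<Longrightarrow> ip (x - orth_proj ip X x) y = 0"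
  using orth_proj_exists[of X x] orth_proj_eqI[of X _ x] by metis+

lemma orth_proj_id: "closed_subspace sc X \<Longrightarrow> x \<in> X \<Longrightarrow> orth_proj ip X x = x"
  by (rule orth_proj_eqI) auto

lemma real_ip_orth_proj:
  assumes "closed_subspace sc X" "y \<in> X"
  shows "real_ip (orth_proj ip X x) y = real_ip x y"
  using real_ip_eq_0[OF ip_orth_proj_diff[OF assms, of x]] by (simp add: rip.diff_left)

text \<open>Self-adjointness and idempotence of the projection in one identity.\<close>

lemma real_ip_orth_proj_self:
  assumes "closed_subspace sc X"
  shows "real_ip (orth_proj ip X x) y = real_ip (orth_proj ip X x) (orth_proj ip X y)"
  using real_ip_orth_proj[OF assms orth_proj_mem[OF assms], of y x] by (simp add: real_ip_commute)

lemma norm_orth_proj_le: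
  assumes "closed_subspace sc X"
  shows "norm (orth_proj ip X x) \<le> norm x"
proof (cases "orth_proj ip X x = 0")
  case False
  have "norm (orth_proj ip X x) * norm (orth_proj ip X x) \<le> norm (orth_proj ip X x) * norm x"
    using real_ip_orth_proj_self[OF assms, of x x] real_ip_le[of "orth_proj ip X x" x]
    by (simp add: real_ip_self power2_eq_square)
  then show ?thesis using False by simp
qed simp

lemma orth_proj_add:
  assumes "closed_subspace sc X"
  shows "orth_proj ip X (x + y) = orth_proj ip X x + orth_proj ip X y"
proof (rule orth_proj_eqI[OF assms])
  show "orth_proj ip X x + orth_proj ip X y \<in> X"
    using assms by (simp add: closed_subspace_def subspace_add orth_proj_mem[OF assms])
  fix z assume "z \<in> X"
  then show "ip (x + y - (orth_proj ip X x + orth_proj ip X y)) z = 0"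
    unfolding add_diff_add by (simp add: ip_add_left ip_orth_proj_diff[OF assms])
qed

lemma orth_proj_scale:
  assumes "closed_subspace sc X"
  shows "orth_proj ip X (sc c x) = sc c (orth_proj ip X x)"
proof (rule orth_proj_eqI[OF assms])
  show "sc c (orth_proj ip X x) \<in> X"
    using assms by (simp add: closed_subspace_def subspace_scale orth_proj_mem[OF assms])
  fix z assume "z \<in> X"
  then show "ip (sc c x - sc c (orth_proj ip X x)) z = 0"
    by (simp add: ip_scale_left ip_orth_proj_diff[OF assms] flip: scale_right_diff_distrib)
qed

text \<open>Real scalars act through \<open>sc\<close>, so homogeneity over the scalar field yields
  the real homogeneity that \<open>bounded_linear\<close> asks for.\<close>

lemma bounded_linearI_scale:
  assumes "\<And>x y. T (x + y) = T x + T y" "\<And>c x. T (sc c x) = sc c (T x)"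
    and "\<And>x. norm (T x) \<le> norm x * C"
  shows "bounded_linear T"
proof (rule bounded_linear_intro)
  show "T (r *\<^sub>R x) = r *\<^sub>R T x" for r x
    by (metis scale_of_real assms(2))
qed (use assms in auto)

lemma bounded_operator_bounded_linear:
  assumes "bounded_operator sc S"
  shows "bounded_linear S" "S (sc c x) = sc c (S x)"
proof -
  have lin: "Vector_Spaces.linear sc sc S" using assms by (simp add: bounded_operator_def)
  obtain C where C: "\<And>x. norm (S x) \<le> norm x * C"
    using assms by (auto simp: bounded_operator_def mult.commute)
  interpret l: Vector_Spaces.linear sc sc S by (rule lin)
  show "bounded_linear S"
    by (rule bounded_linearI_scale[OF l.add l.scale C])
  show "S (sc c x) = sc c (S x)" by (rule l.scale)
qed

lemma closed_subspace_UNIV: "closed_subspace sc UNIV"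
  by (simp add: closed_subspace_def)

lemma bounded_linear_orth_proj:
  "closed_subspace sc X \<Longrightarrow> bounded_linear (orth_proj ip X)"
  by (rule bounded_linearI_scale[where C = 1])
    (simp_all add: orth_proj_add orth_proj_scale norm_orth_proj_le)

section \<open>Closed spans and arguments by density\<close>

lemma closed_subspace_closure_span: "closed_subspace sc (closure (span A))"
proof -
  have "closure (span A) = {x. \<exists>f. (\<forall>n. f n \<in> span A) \<and> f \<longlonglongrightarrow> x}"
    by (rule set_eqI) (simp add: closure_sequential)
  moreover have "subspace {x. \<exists>f. (\<forall>n. f n \<in> span A) \<and> f \<longlonglongrightarrow> x}"
  proof (rule subspaceI; clarsimp)
    show "\<exists>f. (\<forall>n. f n \<in> span A) \<and> f \<longlonglongrightarrow> 0"
      by (rule exI[of _ "\<lambda>_. 0"]) (simp add: span_zero)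
    fix f g x y assume "\<forall>n. f n \<in> span A" "f \<longlonglongrightarrow> x" "\<forall>n. g n \<in> span A" "g \<longlonglongrightarrow> y"
    then show "\<exists>f. (\<forall>n. f n \<in> span A) \<and> f \<longlonglongrightarrow> x + y"
      by (intro exI[of _ "\<lambda>n. f n + g n"]) (auto intro: span_add tendsto_add)
  next
    fix c f x assume "\<forall>n. f n \<in> span A" "f \<longlonglongrightarrow> x"
    then show "\<exists>f. (\<forall>n. f n \<in> span A) \<and> f \<longlonglongrightarrow> sc c x"
      by (intro exI[of _ "\<lambda>n. sc c (f n)"])
        (auto intro: span_scale bounded_linear.tendsto[OF bounded_linear_scale])
  qed
  ultimately have "subspace (closure (span A))" by simp
  then show ?thesis by (simp add: closed_subspace_def)
qed

lemma closure_span_ip_eq_0: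
  assumes "\<And>y. y \<in> A \<Longrightarrow> ip x y = 0" "z \<in> closure (span A)"
  shows "ip x z = 0"
proof -
  have "ip x y = 0" if "y \<in> span A" for y
    using that
    by (induction rule: span_induct_alt) (auto simp: ip_add_right ip_scale_right assms)
  moreover have "continuous_on (closure (span A)) (ip x)"
    by (rule bounded_linear.continuous_on[OF ipb.bounded_linear_right continuous_on_id])
  ultimately show ?thesis
    using assms(2) continuous_constant_on_closure by blast
qed

text \<open>The target type carries only real scalars. Homogeneity is therefore phrased as:
  agreement at a vector passes to its multiples under \<open>sc\<close>.\<close>

lemma bounded_operators_eqI:
  fixes T T' :: "'a \<Rightarrow> 'c::real_normed_vector"
  assumes "bounded_linear T" "bounded_linear T'"
    and "\<And>c x. T x = T' x \<Longrightarrow> T (sc c x) = T' (sc c x)"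
    and "closure (span A) = UNIV" "\<And>x. x \<in> A \<Longrightarrow> T x = T' x"
  shows "T = T'"
proof
  fix x
  have d: "bounded_linear (\<lambda>x. T x - T' x)"
    by (intro bounded_linear_sub assms)
  have "T y - T' y = 0" if "y \<in> span A" for y
    using that
  proof (induction rule: span_induct_alt)
    case base
    then show ?case by (simp add: bounded_linear.linear[OF assms(1)] bounded_linear.linear[OF assms(2)] linear_0)
  next
    case (step c x y)
    then show ?case
      using assms(3)[OF assms(5)[of x]]
      by (simp add: linear_add bounded_linear.linear[OF assms(1)] bounded_linear.linear[OF assms(2)])
  qed
  moreover have "continuous_on (closure (span A)) (\<lambda>x. T x - T' x)"
    by (rule bounded_linear.continuous_on[OF d continuous_on_id])
  ultimately have "T x - T' x = 0"
    using continuous_constant_on_closure assms(4) by blast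
  then show "T x = T' x" by simp
qed

end

section \<open>Frame operators\<close>

text \<open>Cauchy criterion for the net of finite partial sums: the increments of the convergent
  net for \<open>q\<close> control those for \<open>f\<close>, and completeness supplies the
  limit.\<close>

lemma summable_on_if_square_dominated:
  fixes f :: "'i \<Rightarrow> 'a::banach" and q :: "'i \<Rightarrow> real"
  assumes q: "q summable_on N" and C: "C \<ge> 0"
    and dom: "\<And>F. finite F \<Longrightarrow> F \<subseteq> N \<Longrightarrow> (norm (sum f F))\<^sup>2 \<le> C * sum q F"
  shows "f summable_on N"
proof -
  have "\<exists>P. eventually P (finite_subsets_at_top N) \<and>
      (\<forall>F F'. P F \<and> P F' \<longrightarrow> dist (sum f F) (sum f F') < e)" if e: "e > 0" for e
  proof -
    \<comment> \<open>Chosen so that \<open>C * d\<close> is at most the square of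
      \<open>e / 4\<close>; the denominator \<open>C + 1\<close> stays positive when
      \<open>C = 0\<close>.\<close>
    define d where "d = (e / 4)\<^sup>2 / (C + 1)"
    have d: "d > 0" using e C by (simp add: d_def)
    have "(sum q \<longlongrightarrow> infsum q N) (finite_subsets_at_top N)"
      using q by (simp add: has_sum_infsum flip: has_sum_def)
    then have "\<forall>\<^sub>F F in finite_subsets_at_top N. dist (sum q F) (infsum q N) < d / 2"
      using d unfolding tendsto_iff by (meson half_gt_zero)
    then obtain F0 where F0: "finite F0" "F0 \<subseteq> N"
      and close: "finite F \<and> F0 \<subseteq> F \<and> F \<subseteq> N \<Longrightarrow> dist (sum q F) (infsum q N) < d / 2" for F
      by atomize_elim (simp only: eventually_finite_subsets_at_top)
    \<comment> \<open>Both sums of \<open>q\<close> lie within \<open>d / 2\<close> of the limit, so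
      the sum over \<open>F - F0\<close> is below \<open>d\<close>, and the domination applies to
      that difference.\<close>
    have near: "dist (sum f F) (sum f F0) < e / 2" if F: "finite F" "F0 \<subseteq> F" "F \<subseteq> N" for F
    proof -
      have "sum q (F - F0) = sum q F - sum q F0"
        using F by (simp add: sum_diff)
      also have "\<dots> < d"
        using F F0 close[of F] close[of F0] by (simp add: dist_real_def abs_if split: if_splits)
      finally have qd: "sum q (F - F0) < d" .
      have "(norm (sum f (F - F0)))\<^sup>2 \<le> C * sum q (F - F0)"
        using F by (intro dom) auto
      also have "\<dots> \<le> C * d"
        using qd C by (intro mult_left_mono) auto
      also have "\<dots> \<le> (C + 1) * d"
        using d by simp
      also have "\<dots> = (e / 4)\<^sup>2"
        using C by (simp add: d_def)
      finally have "norm (sum f (F - F0)) \<le> e / 4"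
        by (rule power2_le_imp_le) (use e in auto)
      then show ?thesis
        using F e by (simp add: dist_norm sum_diff)
    qed
    show ?thesis
    proof (intro exI conjI allI impI)
      show "\<forall>\<^sub>F F in finite_subsets_at_top N. finite F \<and> F0 \<subseteq> F \<and> F \<subseteq> N"
        unfolding eventually_finite_subsets_at_top using F0 by blast
      fix F F' assume "(finite F \<and> F0 \<subseteq> F \<and> F \<subseteq> N) \<and> finite F' \<and> F0 \<subseteq> F' \<and> F' \<subseteq> N"
      then show "dist (sum f F) (sum f F') < e"
        using near[of F] near[of F'] dist_triangle2[of "sum f F" "sum f F'" "sum f F0"] by simp
    qed
  qed
  then have "cauchy_filter (filtermap (sum f) (finite_subsets_at_top N))"
    by (simp add: cauchy_filter_metric_filtermap)
  moreover have "complete (UNIV :: 'a set)"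
    by (meson Cauchy_convergent UNIV_I complete_def convergent_def)
  ultimately obtain L where "(sum f \<longlongrightarrow> L) (finite_subsets_at_top N)"
    using complete_uniform[where S = UNIV] by (force simp add: filterlim_def)
  then show ?thesis
    using summable_on_def has_sum_def by blast
qed

text \<open>The bound concerns all vectors but only finite subfamilies: finite sums depend
  continuously on the vector, so the bound can be verified on a dense set. Convergence of the full
  series is derived.\<close>

locale bessel_family = hilbert_space sc ip
  for sc :: "'k::real_or_complex \<Rightarrow> 'a::banach \<Rightarrow> 'a" and ip +
  fixes N :: "'n set" and X :: "'n \<Rightarrow> 'a set" and u :: "'n \<Rightarrow> real" and B :: real
  assumes closed_subspaces: "n \<in> N \<Longrightarrow> closed_subspace sc (X n)"
    and bound_pos: "B > 0"
    and bessel_finite: "finite F \<Longrightarrow> F \<subseteq> N \<Longrightarrow>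
      (\<Sum>n\<in>F. (u n)\<^sup>2 * (norm (orth_proj ip (X n) x))\<^sup>2) \<le> B * (norm x)\<^sup>2"
begin

section \<open>The frame operator of a Bessel family\<close>

abbreviation P where "P n \<equiv> orth_proj ip (X n)"

definition frame_op :: "'a \<Rightarrow> 'a" where
  "frame_op x = (\<Sum>\<^sub>\<infinity>n\<in>N. (u n)\<^sup>2 *\<^sub>R P n x)"

lemma bessel_summable: "(\<lambda>n. (u n)\<^sup>2 * (norm (P n x))\<^sup>2) summable_on N"
  by (rule nonneg_bdd_above_summable_on)
    (auto intro!: bdd_aboveI[of _ "B * (norm x)\<^sup>2"] bessel_finite)

lemma bessel_infsum_le: "(\<Sum>\<^sub>\<infinity>n\<in>N. (u n)\<^sup>2 * (norm (P n x))\<^sup>2) \<le> B * (norm x)\<^sup>2"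
  by (intro infsum_le_finite_sums bessel_summable bessel_finite)

text \<open>Pairing the partial sum \<open>y\<close> with itself gives a sum of
  \<open>real_ip (P n x) (P n y)\<close>. Cauchy-Schwarz for sums splits it, the Bessel bound
  absorbs the factor with \<open>y\<close>, and the square of \<open>norm y\<close> cancels. This is
  the domination that makes the frame series converge.\<close>

lemma norm_synthesis_le:
  assumes F: "finite F" "F \<subseteq> N"
  shows "(norm (\<Sum>n\<in>F. (u n)\<^sup>2 *\<^sub>R P n x))\<^sup>2 \<le> B * (\<Sum>n\<in>F. (u n)\<^sup>2 * (norm (P n x))\<^sup>2)"
proof -
  define y where "y = (\<Sum>n\<in>F. (u n)\<^sup>2 *\<^sub>R P n x)"
  define q where "q = (\<Sum>n\<in>F. (u n)\<^sup>2 * (norm (P n x))\<^sup>2)"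
  have q0: "q \<ge> 0" by (simp add: q_def sum_nonneg)
  have "(norm y)\<^sup>2 = (\<Sum>n\<in>F. (u n)\<^sup>2 * real_ip (P n x) y)"
    by (subst real_ip_self[symmetric], subst (1) y_def) (simp add: rip.sum_left rip.scaleR_left)
  also have "\<dots> = (\<Sum>n\<in>F. (u n)\<^sup>2 * real_ip (P n x) (P n y))"
    using F by (intro sum.cong refl arg_cong2[where f = "(*)"] real_ip_orth_proj_self closed_subspaces) auto
  also have "\<dots> \<le> (\<Sum>n\<in>F. (\<bar>u n\<bar> * norm (P n x)) * (\<bar>u n\<bar> * norm (P n y)))"
  proof (rule sum_mono)
    fix n
    have "(u n)\<^sup>2 * real_ip (P n x) (P n y) \<le> \<bar>u n\<bar>\<^sup>2 * (norm (P n x) * norm (P n y))"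
      by (simp add: real_ip_le mult_left_mono)
    then show "(u n)\<^sup>2 * real_ip (P n x) (P n y) \<le> (\<bar>u n\<bar> * norm (P n x)) * (\<bar>u n\<bar> * norm (P n y))"
      by (simp only: power2_eq_square mult_ac)
  qed
  finally have "((norm y)\<^sup>2)\<^sup>2 \<le> (\<Sum>n\<in>F. (\<bar>u n\<bar> * norm (P n x)) * (\<bar>u n\<bar> * norm (P n y)))\<^sup>2"
    by (intro power_mono) auto
  also have "\<dots> \<le> (\<Sum>n\<in>F. (\<bar>u n\<bar> * norm (P n x))\<^sup>2) * (\<Sum>n\<in>F. (\<bar>u n\<bar> * norm (P n y))\<^sup>2)"
    by (rule Cauchy_Schwarz_ineq_sum)
  also have "\<dots> = q * (\<Sum>n\<in>F. (u n)\<^sup>2 * (norm (P n y))\<^sup>2)"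
    by (simp add: q_def power_mult_distrib)
  also have "\<dots> \<le> q * (B * (norm y)\<^sup>2)"
    using bessel_finite[OF F] q0 by (rule mult_left_mono)
  finally have *: "(norm y)\<^sup>2 * (norm y)\<^sup>2 \<le> (norm y)\<^sup>2 * (B * q)"
    by (simp add: power2_eq_square mult_ac)
  have "(norm y)\<^sup>2 \<le> B * q"
  proof (cases "y = 0")
    case True
    then show ?thesis using q0 bound_pos by simp
  next
    case False
    then show ?thesis using * by (simp only: mult_le_cancel_left) simp
  qed
  then show ?thesis by (simp add: y_def q_def)
qed

lemma has_sum_frame_op: "((\<lambda>n. (u n)\<^sup>2 *\<^sub>R P n x) has_sum frame_op x) N"
  unfolding frame_op_def
  using bound_pos norm_synthesis_le
  by (intro has_sum_infsum summable_on_if_square_dominated[OF bessel_summable, of B]) auto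

lemma frame_op_add: "frame_op (x + y) = frame_op x + frame_op y"
proof -
  have "((\<lambda>n. (u n)\<^sup>2 *\<^sub>R P n x + (u n)\<^sup>2 *\<^sub>R P n y) has_sum frame_op x + frame_op y) N"
    by (intro has_sum_add has_sum_frame_op)
  also have "?this \<longleftrightarrow> ((\<lambda>n. (u n)\<^sup>2 *\<^sub>R P n (x + y)) has_sum frame_op x + frame_op y) N"
    by (intro has_sum_cong) (simp add: orth_proj_add[OF closed_subspaces] scaleR_add_right)
  finally show ?thesis using has_sum_frame_op has_sum_unique by blast
qed

lemma frame_op_scale: "frame_op (sc c x) = sc c (frame_op x)"
proof -
  have "((\<lambda>n. sc c ((u n)\<^sup>2 *\<^sub>R P n x)) has_sum sc c (frame_op x)) N"
    by (intro has_sum_bounded_linear[OF bounded_linear_scale] has_sum_frame_op)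
  also have "?this \<longleftrightarrow> ((\<lambda>n. (u n)\<^sup>2 *\<^sub>R P n (sc c x)) has_sum sc c (frame_op x)) N"
    by (intro has_sum_cong)
      (simp add: orth_proj_scale[OF closed_subspaces] linear_scale[OF bounded_linear.linear[OF bounded_linear_scale]])
  finally show ?thesis using has_sum_frame_op has_sum_unique by blast
qed

text \<open>This expansion is symmetric in \<open>x\<close> and \<open>y\<close>, which gives
  self-adjointness; for \<open>x = y\<close> it identifies the quadratic form with the frame
  sum.\<close>

lemma has_sum_real_ip_frame_op:
  "((\<lambda>n. (u n)\<^sup>2 * real_ip (P n x) (P n y)) has_sum real_ip (frame_op x) y) N"
proof -
  have "((\<lambda>n. real_ip ((u n)\<^sup>2 *\<^sub>R P n x) y) has_sum real_ip (frame_op x) y) N"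
    by (intro has_sum_bounded_linear[OF rip.bounded_linear_left] has_sum_frame_op)
  also have "?this \<longleftrightarrow> ?thesis"
    by (intro has_sum_cong) (simp add: rip.scaleR_left real_ip_orth_proj_self[OF closed_subspaces, of _ x y])
  finally show ?thesis .
qed

lemma frame_op_selfadjoint: "real_ip (frame_op x) y = real_ip x (frame_op y)"
  using has_sum_real_ip_frame_op[of x y] has_sum_real_ip_frame_op[of y x] has_sum_unique
  by (simp add: real_ip_commute[of "P _ y"] real_ip_commute[of x]) blast

lemma real_ip_frame_op_self:
  "real_ip (frame_op x) x = (\<Sum>\<^sub>\<infinity>n\<in>N. (u n)\<^sup>2 * (norm (P n x))\<^sup>2)"
  using has_sum_real_ip_frame_op[of x x] by (simp add: real_ip_self infsumI)

text \<open>The synthesis estimate followed by the Bessel bound controls every finite partial sum by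
  \<open>B * norm x\<close>, and the bound survives the limit.\<close>

lemma norm_frame_op_le: "norm (frame_op x) \<le> B * norm x"
proof (cases "frame_op x = 0")
  case True
  then show ?thesis using bound_pos by simp
next
  case False
  have "((\<lambda>F. (norm (\<Sum>n\<in>F. (u n)\<^sup>2 *\<^sub>R P n x))\<^sup>2) \<longlongrightarrow> (norm (frame_op x))\<^sup>2) (finite_subsets_at_top N)"
    using has_sum_frame_op unfolding has_sum_def by (intro tendsto_intros)
  moreover have "\<forall>\<^sub>F F in finite_subsets_at_top N. (norm (\<Sum>n\<in>F. (u n)\<^sup>2 *\<^sub>R P n x))\<^sup>2 \<le> B * (B * (norm x)\<^sup>2)"
  proof (rule eventually_finite_subsets_at_top_weakI)
    fix F assume F: "finite F" "F \<subseteq> N"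
    show "(norm (\<Sum>n\<in>F. (u n)\<^sup>2 *\<^sub>R P n x))\<^sup>2 \<le> B * (B * (norm x)\<^sup>2)"
      using norm_synthesis_le[OF F] bessel_finite[OF F] bound_pos
      by (meson order_trans mult_left_mono less_imp_le)
  qed
  ultimately have "(norm (frame_op x))\<^sup>2 \<le> B * (B * (norm x)\<^sup>2)"
    by (rule tendsto_upperbound) simp
  then have "(norm (frame_op x))\<^sup>2 \<le> (B * norm x)\<^sup>2"
    by (simp add: power2_eq_square mult_ac)
  then show ?thesis
    by (rule power2_le_imp_le) (use bound_pos in auto)
qed

lemma bounded_linear_frame_op: "bounded_linear frame_op"
  by (rule bounded_linearI_scale[where C = B, OF frame_op_add frame_op_scale])
    (simp add: mult.commute[of _ B] norm_frame_op_le)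

lemma bounded_operator_frame_op: "bounded_operator sc frame_op"
  unfolding bounded_operator_def
  using norm_frame_op_le
  by (auto simp: frame_op_add frame_op_scale vector_space_axioms
      intro!: Vector_Spaces.linear.intro module_hom.intro module_hom_axioms.intro module_axioms)

text \<open>The infinite sum is the quadratic form of a bounded operator, hence continuous in
  \<open>x\<close>, so a lower bound extends from a dense set.\<close>

lemma frame_op_ge_closure:
  assumes "\<And>x. x \<in> D \<Longrightarrow> A * (norm x)\<^sup>2 \<le> (\<Sum>\<^sub>\<infinity>n\<in>N. (u n)\<^sup>2 * (norm (P n x))\<^sup>2)"
    and "closure D = UNIV"
  shows "A * (norm x)\<^sup>2 \<le> (\<Sum>\<^sub>\<infinity>n\<in>N. (u n)\<^sup>2 * (norm (P n x))\<^sup>2)"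
proof -
  have "continuous_on (closure D) (\<lambda>x. real_ip (frame_op x) x - A * (norm x)\<^sup>2)"
    by (intro continuous_intros rip.continuous_on bounded_linear.continuous_on[OF bounded_linear_frame_op])
  then have "0 \<le> real_ip (frame_op x) x - A * (norm x)\<^sup>2"
    by (rule continuous_ge_on_closure) (use assms in \<open>auto simp: real_ip_frame_op_self\<close>)
  then show ?thesis by (simp add: real_ip_frame_op_self)
qed

end

section \<open>The lower bound and invertibility of the frame operator\<close>

locale frame_family = bessel_family +
  fixes A :: real
  assumes lower_pos: "A > 0"
    and lower: "A * (norm x)\<^sup>2 \<le> (\<Sum>\<^sub>\<infinity>n\<in>N. (u n)\<^sup>2 * (norm (orth_proj ip (X n) x))\<^sup>2)"
begin

lemma norm_frame_op_ge: "A * norm x \<le> norm (frame_op x)"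
proof (cases "x = 0")
  case False
  have "A * (norm x)\<^sup>2 \<le> norm (frame_op x) * norm x"
    using lower[of x] real_ip_le[of "frame_op x" x] by (simp add: real_ip_frame_op_self)
  then have "norm x * (A * norm x) \<le> norm x * norm (frame_op x)"
    by (simp add: power2_eq_square mult_ac)
  then show ?thesis using False by simp
qed simp

text \<open>An operator that is bounded below maps complete sets to complete sets, so its range is
  closed.\<close>

lemma closed_subspace_range_frame_op: "closed_subspace sc (range frame_op)"
  unfolding closed_subspace_def
proof
  show "subspace (range frame_op)"
  proof (rule subspaceI)
    show "0 \<in> range frame_op"
      by (metis frame_op_scale rangeI scale_zero_left)
  qed (auto simp flip: frame_op_add frame_op_scale)
  show "closed (range frame_op)"
    using norm_frame_op_ge bounded_linear_frame_op complete_UNIV lower_pos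
    by (intro complete_imp_closed complete_isometric_image[of A UNIV frame_op]) auto
qed

lemma bij_frame_op: "bij frame_op"
proof (rule bijI)
  show "inj frame_op"
  proof (rule injI)
    fix x y assume "frame_op x = frame_op y"
    then have "frame_op (x - y) = 0"
      using linear_diff[OF bounded_linear.linear[OF bounded_linear_frame_op]] by simp
    then have "A * norm (x - y) \<le> 0"
      using norm_frame_op_ge[of "x - y"] by simp
    then show "x = y" using lower_pos by (simp add: mult_le_0_iff)
  qed
  show "surj frame_op"
  proof (intro set_eqI iffI UNIV_I)
    fix x
    \<comment> \<open>The residual \<open>y\<close> is orthogonal to the range, in particular to
      \<open>frame_op y\<close>, so the lower bound on the quadratic form forces
      \<open>y = 0\<close>.\<close>
    define y where "y = x - orth_proj ip (range frame_op) x"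
    have "real_ip y (frame_op y) = 0"
      unfolding y_def by (intro real_ip_eq_0 ip_orth_proj_diff closed_subspace_range_frame_op) auto
    then have "A * (norm y)\<^sup>2 \<le> 0"
      using lower[of y] by (simp add: real_ip_frame_op_self[symmetric] real_ip_commute)
    then have "y = 0" using lower_pos by (simp add: mult_le_0_iff)
    then show "x \<in> range frame_op"
      using orth_proj_mem[OF closed_subspace_range_frame_op, of x] by (simp add: y_def)
  qed
qed

end

section \<open>The inverse frame operator and the canonical dual\<close>

context frame_family
begin

abbreviation R where "R \<equiv> inv frame_op"

lemma frame_op_R [simp]: "frame_op (R x) = x"
  by (simp add: bij_frame_op bij_is_surj surj_f_inv_f)

lemma R_frame_op [simp]: "R (frame_op x) = x"
  by (simp add: bij_frame_op bij_is_inj inv_f_f)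

lemma R_image: "R ` Z = frame_op -` Z"
  by (simp add: bij_frame_op bij_vimage_eq_inv_image)

lemma R_add: "R (x + y) = R x + R y"
  by (metis frame_op_add frame_op_R R_frame_op)

lemma R_scale: "R (sc c x) = sc c (R x)"
  by (metis frame_op_scale frame_op_R R_frame_op)

lemma norm_R_le: "norm (R x) \<le> norm x / A"
  using norm_frame_op_ge[of "R x"] lower_pos by (simp add: pos_le_divide_eq mult.commute)

lemma bounded_linear_R: "bounded_linear R"
  by (rule bounded_linearI_scale[where C = "1 / A", OF R_add R_scale]) (simp add: norm_R_le)

lemma R_selfadjoint: "real_ip (R x) y = real_ip x (R y)"
  by (metis frame_op_selfadjoint frame_op_R)

text \<open>The image under \<open>R\<close> is the preimage under the continuous map
  \<open>frame_op\<close>, so closedness is inherited.\<close>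

lemma closed_subspace_R_image:
  assumes "closed_subspace sc Z"
  shows "closed_subspace sc (R ` Z)"
  unfolding closed_subspace_def
proof
  have Z: "subspace Z" "closed Z" using assms by (auto simp: closed_subspace_def)
  show "subspace (R ` Z)"
  proof (rule subspaceI)
    show "0 \<in> R ` Z"
      unfolding R_image using subspace_0[OF Z(1)]
      by (simp add: linear_0[OF bounded_linear.linear[OF bounded_linear_frame_op]])
  qed (auto simp: R_image frame_op_add frame_op_scale intro: subspace_add[OF Z(1)] subspace_scale[OF Z(1)])
  show "closed (R ` Z)"
    unfolding R_image
    by (intro closed_vimage Z bounded_linear.continuous_on[OF bounded_linear_frame_op] continuous_on_id)
qed

text \<open>\<open>R\<close> is applied termwise to the frame series of \<open>x\<close>; each
  \<open>R (P n x)\<close> already lies in \<open>R\<close> followed by the image of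
  \<open>X n\<close>, so the outer projection fixes it.\<close>

lemma canonical_dual_reconstruction:
  "((\<lambda>n. (u n)\<^sup>2 *\<^sub>R orth_proj ip (R ` X n) (R (P n x))) has_sum x) N"
proof -
  have "((\<lambda>n. R ((u n)\<^sup>2 *\<^sub>R P n x)) has_sum R (frame_op x)) N"
    by (intro has_sum_bounded_linear[OF bounded_linear_R] has_sum_frame_op)
  also have "?this \<longleftrightarrow> ?thesis"
    unfolding R_frame_op
    by (intro has_sum_cong)
      (simp add: linear_scale[OF bounded_linear.linear[OF bounded_linear_R]]
        orth_proj_id closed_subspace_R_image closed_subspaces orth_proj_mem)
  finally show ?thesis .
qed

text \<open>Write \<open>S\<close> for the frame operator and \<open>Q\<close> for the projection onto \<open>R (X n)\<close>. Since \<open>R\<close> and \<open>S\<close>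
  are self-adjoint, \<open>P n R = P n R Q\<close> and \<open>Q S = Q S P n\<close>, so that also \<open>Q = Q S (P n R)\<close>.\<close>

lemma norm_P_R_le:
  assumes "n \<in> N"
  shows "A * norm (P n (R x)) \<le> norm (orth_proj ip (R ` X n) x)"
proof (cases "P n (R x) = 0")
  case False
  note cs = closed_subspaces[OF assms]
  note cs' = closed_subspace_R_image[OF cs]
  let ?z = "P n (R x)"
  have "(norm ?z)\<^sup>2 = real_ip (R x) ?z"
    by (simp add: real_ip_orth_proj[OF cs orth_proj_mem[OF cs], symmetric] real_ip_self)
  also have "\<dots> = real_ip (orth_proj ip (R ` X n) x) (R ?z)"
    by (simp add: R_selfadjoint real_ip_orth_proj[OF cs'] orth_proj_mem[OF cs])
  also have "\<dots> \<le> norm (orth_proj ip (R ` X n) x) * norm (R ?z)"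
    by (rule real_ip_le)
  also have "\<dots> \<le> norm (orth_proj ip (R ` X n) x) * (norm ?z / A)"
    by (intro mult_left_mono norm_R_le) simp
  finally have "norm ?z * (A * norm ?z) \<le> norm ?z * norm (orth_proj ip (R ` X n) x)"
    using lower_pos by (simp add: power2_eq_square field_simps)
  then show ?thesis using False by simp
qed simp

lemma norm_dual_proj_le:
  assumes "n \<in> N"
  shows "norm (orth_proj ip (R ` X n) x) \<le> B * norm (P n (R x))"
proof (cases "orth_proj ip (R ` X n) x = 0")
  case True
  then show ?thesis using bound_pos by simp
next
  case False
  note cs = closed_subspaces[OF assms]
  note cs' = closed_subspace_R_image[OF cs]
  let ?y = "orth_proj ip (R ` X n) x"
  have y: "frame_op ?y \<in> X n"
    using orth_proj_mem[OF cs', of x] by (auto simp: R_image)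
  have "(norm ?y)\<^sup>2 = real_ip x ?y"
    by (simp add: real_ip_orth_proj[OF cs' orth_proj_mem[OF cs'], symmetric] real_ip_self)
  also have "\<dots> = real_ip (P n (R x)) (frame_op ?y)"
    by (simp add: real_ip_orth_proj[OF cs y] R_selfadjoint)
  also have "\<dots> \<le> norm (P n (R x)) * norm (frame_op ?y)"
    by (rule real_ip_le)
  also have "\<dots> \<le> norm (P n (R x)) * (B * norm ?y)"
    by (intro mult_left_mono norm_frame_op_le) simp
  finally have "norm ?y * norm ?y \<le> norm ?y * (B * norm (P n (R x)))"
    by (simp add: power2_eq_square mult_ac)
  then show ?thesis using False by simp
qed

text \<open>The two preceding estimates place each term between \<open>A^2\<close> and
  \<open>B^2\<close> times the frame term at \<open>R x\<close>. The frame bounds at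
  \<open>R x\<close>, with \<open>norm x / B\<close> and \<open>norm x / A\<close> as bounds for
  \<open>norm (R x)\<close>, give the constants.\<close>

lemma canonical_dual_frame:
  "(\<lambda>n. (u n)\<^sup>2 * (norm (orth_proj ip (R ` X n) x))\<^sup>2) summable_on N"
  "A ^ 3 / B\<^sup>2 * (norm x)\<^sup>2 \<le> (\<Sum>\<^sub>\<infinity>n\<in>N. (u n)\<^sup>2 * (norm (orth_proj ip (R ` X n) x))\<^sup>2)"
  "(\<Sum>\<^sub>\<infinity>n\<in>N. (u n)\<^sup>2 * (norm (orth_proj ip (R ` X n) x))\<^sup>2) \<le> B ^ 3 / A\<^sup>2 * (norm x)\<^sup>2"
proof -
  let ?q = "\<lambda>n. (u n)\<^sup>2 * (norm (P n (R x)))\<^sup>2"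
  let ?q' = "\<lambda>n. (u n)\<^sup>2 * (norm (orth_proj ip (R ` X n) x))\<^sup>2"
  have up: "?q' n \<le> B\<^sup>2 * ?q n" if "n \<in> N" for n
  proof -
    have "?q' n \<le> (u n)\<^sup>2 * (B * norm (P n (R x)))\<^sup>2"
      by (intro mult_left_mono power_mono norm_dual_proj_le that) auto
    then show ?thesis by (simp add: power_mult_distrib mult.left_commute)
  qed
  have low: "A\<^sup>2 * ?q n \<le> ?q' n" if "n \<in> N" for n
  proof -
    have "(u n)\<^sup>2 * (A * norm (P n (R x)))\<^sup>2 \<le> ?q' n"
      using lower_pos by (intro mult_left_mono power_mono norm_P_R_le that) auto
    then show ?thesis by (simp add: power_mult_distrib mult.left_commute)
  qed
  have sq: "?q summable_on N" by (rule bessel_summable)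
  have sB: "(\<lambda>n. B\<^sup>2 * ?q n) summable_on N" and sA: "(\<lambda>n. A\<^sup>2 * ?q n) summable_on N"
    by (intro summable_on_cmult_right sq)+
  show sq': "?q' summable_on N"
    using summable_on_comparison_test[OF sB up] by simp
  have "infsum ?q' N \<le> (\<Sum>\<^sub>\<infinity>n\<in>N. B\<^sup>2 * ?q n)"
    by (intro infsum_mono sq' sB up)
  also have "\<dots> = B\<^sup>2 * infsum ?q N"
    by (simp add: infsum_cmult_right')
  also have "\<dots> \<le> B\<^sup>2 * (B * (norm (R x))\<^sup>2)"
    by (intro mult_left_mono bessel_infsum_le) simp
  also have "\<dots> \<le> B\<^sup>2 * (B * (norm x / A)\<^sup>2)"
    using bound_pos by (intro mult_left_mono power_mono norm_R_le) auto
  also have "\<dots> = B ^ 3 / A\<^sup>2 * (norm x)\<^sup>2"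
    by (simp add: power_divide power3_eq_cube power2_eq_square)
  finally show "infsum ?q' N \<le> B ^ 3 / A\<^sup>2 * (norm x)\<^sup>2" .
  have "norm x / B \<le> norm (R x)"
    using norm_frame_op_le[of "R x"] bound_pos by (simp add: pos_divide_le_eq mult.commute)
  then have "(norm x / B)\<^sup>2 \<le> (norm (R x))\<^sup>2"
    using bound_pos by (intro power_mono) auto
  then have "A\<^sup>2 * (A * (norm x / B)\<^sup>2) \<le> A\<^sup>2 * (A * (norm (R x))\<^sup>2)"
    using lower_pos by (intro mult_left_mono) auto
  moreover have "A ^ 3 / B\<^sup>2 * (norm x)\<^sup>2 = A\<^sup>2 * (A * (norm x / B)\<^sup>2)"
    by (simp add: power_divide power3_eq_cube power2_eq_square)
  ultimately have "A ^ 3 / B\<^sup>2 * (norm x)\<^sup>2 \<le> A\<^sup>2 * (A * (norm (R x))\<^sup>2)" by simp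
  also have "\<dots> \<le> A\<^sup>2 * infsum ?q N"
    by (intro mult_left_mono lower) simp
  also have "\<dots> = (\<Sum>\<^sub>\<infinity>n\<in>N. A\<^sup>2 * ?q n)"
    by (simp add: infsum_cmult_right')
  also have "\<dots> \<le> infsum ?q' N"
    by (intro infsum_mono sq' sA low)
  finally show "A ^ 3 / B\<^sup>2 * (norm x)\<^sup>2 \<le> infsum ?q' N" .
qed

end

section \<open>Tensor products of fusion frames\<close>

lemma fusion_frameE:
  assumes "fusion_frame sc ip I V v"
  obtains A B where "0 < A" "A \<le> B" "\<And>i. i \<in> I \<Longrightarrow> closed_subspace sc (V i)"
    "\<And>f. (\<lambda>i. (v i)\<^sup>2 * (norm (orth_proj ip (V i) f))\<^sup>2) summable_on I"
    "\<And>f. A * (norm f)\<^sup>2 \<le> (\<Sum>\<^sub>\<infinity>i\<in>I. (v i)\<^sup>2 * (norm (orth_proj ip (V i) f))\<^sup>2)"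
    "\<And>f. (\<Sum>\<^sub>\<infinity>i\<in>I. (v i)\<^sup>2 * (norm (orth_proj ip (V i) f))\<^sup>2) \<le> B * (norm f)\<^sup>2"
proof -
  obtain A B where "0 < A" "A \<le> B" "\<forall>i\<in>I. closed_subspace sc (V i)"
    "\<forall>f. (\<lambda>i. (v i)\<^sup>2 * (norm (orth_proj ip (V i) f))\<^sup>2) summable_on I \<and>
      A * (norm f)\<^sup>2 \<le> (\<Sum>\<^sub>\<infinity>i\<in>I. (v i)\<^sup>2 * (norm (orth_proj ip (V i) f))\<^sup>2) \<and>
      (\<Sum>\<^sub>\<infinity>i\<in>I. (v i)\<^sup>2 * (norm (orth_proj ip (V i) f))\<^sup>2) \<le> B * (norm f)\<^sup>2"
    using assms unfolding fusion_frame_def by auto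
  then show thesis by (intro that[of A B]) auto
qed

lemma has_sum_finite_sum:
  fixes f :: "'a \<Rightarrow> 'b \<Rightarrow> 'c::topological_comm_monoid_add"
  assumes "\<And>k. k \<in> K \<Longrightarrow> (f k has_sum s k) I"
  shows "((\<lambda>i. \<Sum>k\<in>K. f k i) has_sum (\<Sum>k\<in>K. s k)) I"
  using assms by (induction K rule: infinite_finite_induct) (auto intro: has_sum_add)

section \<open>Elementary tensors and projections onto tensor subspaces\<close>

context hilbert_tensor_product
begin

lemma norm_tens: "norm (tens f g) = norm f * norm g"
proof -
  have "(of_real ((norm (tens f g))\<^sup>2) :: 'k) = of_real ((norm f * norm g)\<^sup>2)"
    by (simp only: T.ip_self[symmetric] ip_tens H.ip_self K.ip_self power_mult_distrib of_real_mult)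
  then show ?thesis
    by (simp only: of_real_eq_iff) (simp add: power2_eq_iff_nonneg)
qed

lemma bounded_bilinear_tens: "bounded_bilinear tens"
proof
  show "tens (r *\<^sub>R f) g = r *\<^sub>R tens f g" for r f g
    by (metis tens_scale_left H.scale_of_real T.scale_of_real)
  show "tens f (r *\<^sub>R g) = r *\<^sub>R tens f g" for r f g
    by (metis tens_scale_right K.scale_of_real T.scale_of_real)
  show "\<exists>K. \<forall>a b. norm (tens a b) \<le> norm a * norm b * K"
    by (rule exI[of _ 1]) (simp add: norm_tens)
qed (simp_all add: tens_add_left tens_add_right)

sublocale tens: bounded_bilinear tens
  by (rule bounded_bilinear_tens)

lemma closed_subspace_tensor: "closed_subspace sT (tensor_subspace sT tens X Y)"
  unfolding tensor_subspace_def by (rule T.closed_subspace_closure_span)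

text \<open>With \<open>p\<close>, \<open>q\<close> the two projections, the residual splits as
  \<open>tens (f - p) g + tens p (g - q)\<close>; each summand is orthogonal to the generators
  because inner products multiply.\<close>

lemma orth_proj_tens:
  assumes X: "closed_subspace sH X" and Y: "closed_subspace sK Y"
  shows "orth_proj ipT (tensor_subspace sT tens X Y) (tens f g)
    = tens (orth_proj ipH X f) (orth_proj ipK Y g)"
proof (rule T.orth_proj_eqI[OF closed_subspace_tensor])
  let ?p = "orth_proj ipH X f" and ?q = "orth_proj ipK Y g"
  have "tens ?p ?q \<in> {tens f g |f g. f \<in> X \<and> g \<in> Y}"
    using H.orth_proj_mem[OF X] K.orth_proj_mem[OF Y] by blast
  then show "tens ?p ?q \<in> tensor_subspace sT tens X Y"
    unfolding tensor_subspace_def by (intro subsetD[OF closure_subset] T.span_base)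
  have "tens f g - tens ?p ?q = tens (f - ?p) g + tens ?p (g - ?q)"
    by (simp add: tens.diff_left tens.diff_right)
  then have "ipT (tens f g - tens ?p ?q) (tens f' g') = 0" if "f' \<in> X" "g' \<in> Y" for f' g'
    using that by (simp add: T.ip_add_left ip_tens H.ip_orth_proj_diff[OF X] K.ip_orth_proj_diff[OF Y])
  then show "ipT (tens f g - tens ?p ?q) z = 0" if "z \<in> tensor_subspace sT tens X Y" for z
    by (intro T.closure_span_ip_eq_0[OF _ that[unfolded tensor_subspace_def]]) blast
qed

text \<open>Both sides are bounded operators that agree on elementary tensors. The factorisation
  allows the frame inequalities to be treated one factor at a time.\<close>

lemma orth_proj_tensor_subspace_eq_comp:
  assumes X: "closed_subspace sH X" and Y: "closed_subspace sK Y"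
  shows "orth_proj ipT (tensor_subspace sT tens X Y) x =
    orth_proj ipT (tensor_subspace sT tens UNIV Y) (orth_proj ipT (tensor_subspace sT tens X UNIV) x)"
proof -
  have "orth_proj ipT (tensor_subspace sT tens X Y) =
    (\<lambda>x. orth_proj ipT (tensor_subspace sT tens UNIV Y) (orth_proj ipT (tensor_subspace sT tens X UNIV) x))"
  proof (rule T.bounded_operators_eqI[OF _ _ _ tens_total])
    show "bounded_linear (\<lambda>x. orth_proj ipT (tensor_subspace sT tens UNIV Y)
        (orth_proj ipT (tensor_subspace sT tens X UNIV) x))"
      by (intro bounded_linear_compose[OF T.bounded_linear_orth_proj T.bounded_linear_orth_proj]
          closed_subspace_tensor)
  qed (auto simp: T.bounded_linear_orth_proj T.orth_proj_scale closed_subspace_tensor orth_proj_tens X Y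
      H.closed_subspace_UNIV K.closed_subspace_UNIV H.orth_proj_id K.orth_proj_id)
  then show ?thesis by (rule fun_cong)
qed

text \<open>Gram--Schmidt without normalisation; the \<^term>\<open>e k\<close> may vanish.\<close>

lemma span_tens_orthogonal:
  assumes "x \<in> T.span {tens f g |f g. True}"
  shows "\<exists>n (f :: nat \<Rightarrow> 'h) e. x = (\<Sum>k<n. tens (f k) (e k)) \<and>
    (\<forall>k<n. \<forall>l<n. k \<noteq> l \<longrightarrow> ipK (e k) (e l) = 0)"
  using assms
proof (induction rule: T.span_induct_alt)
  case base
  show ?case by (rule exI[of _ 0]) simp
next
  case (step c x y)
  obtain f0 g where x: "x = tens f0 g" using step by blast
  obtain n and f :: "nat \<Rightarrow> 'h" and e where y: "y = (\<Sum>k<n. tens (f k) (e k))"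
    and orth: "\<And>k l. k < n \<Longrightarrow> l < n \<Longrightarrow> k \<noteq> l \<Longrightarrow> ipK (e k) (e l) = 0"
    using step by blast
  define F where "F = sH c f0"
  \<comment> \<open>If \<open>e k = 0\<close>, the quotient is 0 by the convention for division, and
    \<open>ipK g (e k)\<close> is 0 too, so \<open>a k * ipK (e k) (e k) = ipK g (e k)\<close> holds
    in every case.\<close>
  define a where "a k = ipK g (e k) / ipK (e k) (e k)" for k
  define r where "r = g - (\<Sum>k<n. sK (a k) (e k))"
  \<comment> \<open>Expanding \<open>g\<close> along the \<open>e k\<close> and the remainder
    \<open>r\<close> turns \<open>tens F g\<close> into corrections of the old left factors plus one
    new term \<open>tens F r\<close>.\<close>
  define f' where "f' k = (if k < n then f k + sH (a k) F else F)" for k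
  define e' where "e' k = (if k < n then e k else r)" for k
  have r_orth: "ipK r (e l) = 0" if l: "l < n" for l
  proof -
    have "(\<Sum>k<n. ipK (sK (a k) (e k)) (e l)) = (\<Sum>k<n. if k = l then a l * ipK (e l) (e l) else 0)"
      using l by (intro sum.cong refl) (auto simp: K.ip_scale_left orth)
    also have "\<dots> = ipK g (e l)"
      using l by (simp add: a_def K.ip_self)
    finally show ?thesis by (simp add: r_def K.ipb.diff_left K.ipb.sum_left)
  qed
  have "tens F (r + (\<Sum>k<n. sK (a k) (e k))) = tens F r + (\<Sum>k<n. tens (sH (a k) F) (e k))"
    by (simp only: tens.add_right tens.sum_right tens_scale_left tens_scale_right)
  then have "tens F g = tens F r + (\<Sum>k<n. tens (sH (a k) F) (e k))"
    by (simp add: r_def)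
  moreover have "sT c x = tens F g"
    by (simp add: x F_def tens_scale_left)
  ultimately have "sT c x + y = (\<Sum>k<Suc n. tens (f' k) (e' k))"
    by (simp add: y f'_def e'_def tens_add_left sum.distrib)
  moreover have "ipK (e' k) (e' l) = 0" if "k < Suc n" "l < Suc n" "k \<noteq> l" for k l
    using that orth r_orth r_orth[THEN K.ip_eq_0_commute[THEN iffD1]]
    by (auto simp: e'_def less_Suc_eq)
  ultimately show ?case by blast
qed

lemma norm_sum_tens_orthogonal:
  assumes "\<And>k l. k < n \<Longrightarrow> l < n \<Longrightarrow> k \<noteq> l \<Longrightarrow> ipK (e k) (e l) = 0"
  shows "(norm (\<Sum>k<n. tens (f k) (e k)))\<^sup>2 = (\<Sum>k<n::nat. (norm (f k))\<^sup>2 * (norm (e k))\<^sup>2)"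
  using assms
proof (induction n)
  case (Suc n)
  have "real_ip (tens (f k) (e k)) (tens (f n) (e n)) = 0" if "k < n" for k
    using that Suc.prems by (intro T.real_ip_eq_0) (simp add: ip_tens)
  then have "real_ip (\<Sum>k<n. tens (f k) (e k)) (tens (f n) (e n)) = 0"
    by (simp add: T.rip.sum_left)
  then show ?case
    using Suc by (simp add: norm_add_sq norm_tens power_mult_distrib)
qed simp

text \<open>On the algebraic span, the orthogonal representation reduces both inequalities to those
  for the left factors \<open>f k\<close>, weighted by the squared norms of the \<open>e k\<close>.
  Density of the span extends them to the whole space.\<close>

lemma frame_family_tensor_left:
  assumes A: "0 < A" and AB: "A \<le> B" and cs: "\<And>i. i \<in> I \<Longrightarrow> closed_subspace sH (V i)"
    and sm: "\<And>f. (\<lambda>i. (v i)\<^sup>2 * (norm (orth_proj ipH (V i) f))\<^sup>2) summable_on I"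
    and lo: "\<And>f. A * (norm f)\<^sup>2 \<le> (\<Sum>\<^sub>\<infinity>i\<in>I. (v i)\<^sup>2 * (norm (orth_proj ipH (V i) f))\<^sup>2)"
    and up: "\<And>f. (\<Sum>\<^sub>\<infinity>i\<in>I. (v i)\<^sup>2 * (norm (orth_proj ipH (V i) f))\<^sup>2) \<le> B * (norm f)\<^sup>2"
  shows "frame_family sT ipT I (\<lambda>i. tensor_subspace sT tens (V i) UNIV) v B A"
proof -
  let ?D = "T.span {tens f g |f g. True}"
  let ?P = "\<lambda>i. orth_proj ipT (tensor_subspace sT tens (V i) UNIV)"
  let ?q = "\<lambda>f. \<Sum>\<^sub>\<infinity>i\<in>I. (v i)\<^sup>2 * (norm (orth_proj ipH (V i) f))\<^sup>2"
  have D: "\<exists>s. ((\<lambda>i. (v i)\<^sup>2 * (norm (?P i x))\<^sup>2) has_sum s) I \<and> A * (norm x)\<^sup>2 \<le> s \<and> s \<le> B * (norm x)\<^sup>2"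
    if "x \<in> ?D" for x
  proof -
    obtain n and f :: "nat \<Rightarrow> 'h" and e where x: "x = (\<Sum>k<n. tens (f k) (e k))"
      and orth: "\<And>k l. k < n \<Longrightarrow> l < n \<Longrightarrow> k \<noteq> l \<Longrightarrow> ipK (e k) (e l) = 0"
      using span_tens_orthogonal[OF \<open>x \<in> ?D\<close>] by blast
    have nx: "(norm x)\<^sup>2 = (\<Sum>k<n. (norm (f k))\<^sup>2 * (norm (e k))\<^sup>2)"
      unfolding x by (rule norm_sum_tens_orthogonal[OF orth])
    have "((\<lambda>i. \<Sum>k<n. (v i)\<^sup>2 * (norm (orth_proj ipH (V i) (f k)))\<^sup>2 * (norm (e k))\<^sup>2)
        has_sum (\<Sum>k<n. ?q (f k) * (norm (e k))\<^sup>2)) I"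
      by (intro has_sum_finite_sum has_sum_cmult_left has_sum_infsum sm)
    also have "?this \<longleftrightarrow> ((\<lambda>i. (v i)\<^sup>2 * (norm (?P i x))\<^sup>2) has_sum (\<Sum>k<n. ?q (f k) * (norm (e k))\<^sup>2)) I"
    proof (rule has_sum_cong)
      fix i assume i: "i \<in> I"
      \<comment> \<open>The projection changes only the left factors; the \<open>e k\<close> stay
        orthogonal, so Pythagoras applies to the projected sum as well.\<close>
      have "?P i x = (\<Sum>k<n. tens (orth_proj ipH (V i) (f k)) (e k))"
        unfolding x
        by (simp add: linear_sum[OF bounded_linear.linear[OF T.bounded_linear_orth_proj]]
            closed_subspace_tensor orth_proj_tens cs[OF i] K.closed_subspace_UNIV K.orth_proj_id)
      then show "(\<Sum>k<n. (v i)\<^sup>2 * (norm (orth_proj ipH (V i) (f k)))\<^sup>2 * (norm (e k))\<^sup>2)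
          = (v i)\<^sup>2 * (norm (?P i x))\<^sup>2"
        by (simp add: norm_sum_tens_orthogonal[OF orth] sum_distrib_left mult.assoc)
    qed
    finally have hs: "((\<lambda>i. (v i)\<^sup>2 * (norm (?P i x))\<^sup>2) has_sum (\<Sum>k<n. ?q (f k) * (norm (e k))\<^sup>2)) I" .
    moreover have "A * (norm x)\<^sup>2 \<le> (\<Sum>k<n. ?q (f k) * (norm (e k))\<^sup>2)"
      unfolding nx sum_distrib_left mult.assoc[symmetric]
      by (intro sum_mono mult_right_mono lo) simp
    moreover have "(\<Sum>k<n. ?q (f k) * (norm (e k))\<^sup>2) \<le> B * (norm x)\<^sup>2"
      unfolding nx sum_distrib_left mult.assoc[symmetric]
      by (intro sum_mono mult_right_mono up) simp
    ultimately show ?thesis by blast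
  qed
  interpret bessel_family sT ipT I "\<lambda>i. tensor_subspace sT tens (V i) UNIV" v B
  proof
    show "closed_subspace sT (tensor_subspace sT tens (V i) UNIV)" for i
      by (rule closed_subspace_tensor)
    show "0 < B" using A AB by simp
    fix F x assume F: "finite F" "F \<subseteq> I"
    \<comment> \<open>As \<open>F\<close> is finite, \<open>?h\<close> is continuous, so its
      nonnegativity passes from the dense span to \<open>x\<close>.\<close>
    let ?h = "\<lambda>x. B * (norm x)\<^sup>2 - (\<Sum>i\<in>F. (v i)\<^sup>2 * (norm (?P i x))\<^sup>2)"
    have "0 \<le> ?h y" if y: "y \<in> ?D" for y
    proof -
      obtain s where s: "((\<lambda>i. (v i)\<^sup>2 * (norm (?P i y))\<^sup>2) has_sum s) I" "s \<le> B * (norm y)\<^sup>2"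
        using D[OF y] by blast
      show ?thesis using finite_sum_le_has_sum[OF s(1) F] s(2) by simp
    qed
    moreover have "continuous_on (closure ?D) ?h"
      by (intro continuous_intros
          bounded_linear.continuous_on[OF T.bounded_linear_orth_proj[OF closed_subspace_tensor]])
    moreover have "x \<in> closure ?D" using tens_total by simp
    ultimately have "0 \<le> ?h x"
      by (intro continuous_ge_on_closure[of ?D ?h x 0])
    then show "(\<Sum>i\<in>F. (v i)\<^sup>2 * (norm (?P i x))\<^sup>2) \<le> B * (norm x)\<^sup>2" by simp
  qed
  show ?thesis
  proof
    show "A * (norm x)\<^sup>2 \<le> (\<Sum>\<^sub>\<infinity>i\<in>I. (v i)\<^sup>2 * (norm (?P i x))\<^sup>2)" for x
      by (rule frame_op_ge_closure[OF _ tens_total]) (use D infsumI in fastforce)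
  qed (rule A)
qed

section \<open>Exchange of the factors and the full tensor product family\<close>

lemma hilbert_tensor_product_swap: "hilbert_tensor_product sK ipK sH ipH sT ipT (\<lambda>g f. tens f g)"
proof -
  have "{tens f g |g f. True} = {tens f g |f g. True}" by blast
  then show ?thesis
    using tens_total
    by unfold_locales (simp_all add: tens_add_left tens_add_right tens_scale_left tens_scale_right ip_tens)
qed

lemma tensor_subspace_swap: "tensor_subspace sT (\<lambda>g f. tens f g) Y X = tensor_subspace sT tens X Y"
proof -
  have "{tens f g |g f. g \<in> Y \<and> f \<in> X} = {tens f g |f g. f \<in> X \<and> g \<in> Y}" by blast
  then show ?thesis by (simp add: tensor_subspace_def)
qed

text \<open>Factoring each projection turns the frame sum into an iterated sum. The inner one is
  estimated at \<open>V.P i x\<close> by the bounds for \<open>W\<close>, the outer one by those for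
  \<open>V\<close>, so the constants multiply.\<close>

lemma frame_family_tensor:
  assumes V: "fusion_frame sH ipH I V v" and W: "fusion_frame sK ipK J W w"
  obtains A B where "frame_family sT ipT (I \<times> J) (\<lambda>(i, j). tensor_subspace sT tens (V i) (W j))
    (\<lambda>(i, j). v i * w j) B A"
proof -
  obtain A1 B1 where "frame_family sT ipT I (\<lambda>i. tensor_subspace sT tens (V i) UNIV) v B1 A1"
    and csV: "\<And>i. i \<in> I \<Longrightarrow> closed_subspace sH (V i)"
    by (rule fusion_frameE[OF V]) (rule that[OF frame_family_tensor_left])
  then interpret V: frame_family sT ipT I "\<lambda>i. tensor_subspace sT tens (V i) UNIV" v B1 A1 by simp
  \<comment> \<open>With the factors exchanged, the result for left factors yields the one for the
    subspaces built from \<open>W j\<close>.\<close>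
  interpret swap: hilbert_tensor_product sK ipK sH ipH sT ipT "\<lambda>g f. tens f g"
    by (rule hilbert_tensor_product_swap)
  obtain A2 B2 where "frame_family sT ipT J (\<lambda>j. tensor_subspace sT tens UNIV (W j)) w B2 A2"
    and csW: "\<And>j. j \<in> J \<Longrightarrow> closed_subspace sK (W j)"
    by (rule fusion_frameE[OF W]) (rule that[OF swap.frame_family_tensor_left[unfolded tensor_subspace_swap]])
  then interpret W: frame_family sT ipT J "\<lambda>j. tensor_subspace sT tens UNIV (W j)" w B2 A2 by simp
  let ?X = "\<lambda>(i, j). tensor_subspace sT tens (V i) (W j)" and ?u = "\<lambda>(i, j). v i * w j"
  let ?q = "\<lambda>x n. (?u n)\<^sup>2 * (norm (orth_proj ipT (?X n) x))\<^sup>2"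
  have q: "?q x (i, j) = (v i)\<^sup>2 * ((w j)\<^sup>2 * (norm (W.P j (V.P i x)))\<^sup>2)" if "i \<in> I" "j \<in> J" for x i j
    using orth_proj_tensor_subspace_eq_comp[OF csV[OF that(1)] csW[OF that(2)]]
    by (simp add: power_mult_distrib)
  interpret VW: bessel_family sT ipT "I \<times> J" ?X ?u "B1 * B2"
  proof
    show "closed_subspace sT (?X n)" for n
      by (simp add: split_beta closed_subspace_tensor)
    show "0 < B1 * B2" using V.bound_pos W.bound_pos by simp
    fix F x assume F: "finite F" "F \<subseteq> I \<times> J"
    define F1 where "F1 = fst ` F"
    define F2 where "F2 = snd ` F"
    have fin: "finite F1" "finite F2" "F1 \<subseteq> I" "F2 \<subseteq> J"
      using F by (auto simp: F1_def F2_def)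
    \<comment> \<open>The terms are nonnegative, so \<open>F\<close> may be enlarged to a rectangle,
      where the double sum iterates.\<close>
    have "sum (?q x) F \<le> sum (?q x) (F1 \<times> F2)"
      using fin by (intro sum_mono2) (auto simp: F1_def F2_def intro: rev_image_eqI)
    also have "\<dots> = (\<Sum>i\<in>F1. \<Sum>j\<in>F2. ?q x (i, j))"
      by (simp only: sum.cartesian_product split_def prod.collapse)
    also have "\<dots> = (\<Sum>i\<in>F1. (v i)\<^sup>2 * (\<Sum>j\<in>F2. (w j)\<^sup>2 * (norm (W.P j (V.P i x)))\<^sup>2))"
      unfolding sum_distrib_left using fin by (intro sum.cong refl q) auto
    also have "\<dots> \<le> (\<Sum>i\<in>F1. (v i)\<^sup>2 * (B2 * (norm (V.P i x))\<^sup>2))"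
      by (intro sum_mono mult_left_mono W.bessel_finite fin) simp
    also have "\<dots> = B2 * (\<Sum>i\<in>F1. (v i)\<^sup>2 * (norm (V.P i x))\<^sup>2)"
      by (simp add: sum_distrib_left mult.left_commute)
    also have "\<dots> \<le> B2 * (B1 * (norm x)\<^sup>2)"
      using W.bound_pos by (intro mult_left_mono V.bessel_finite fin) simp
    finally show "sum (?q x) F \<le> B1 * B2 * (norm x)\<^sup>2"
      by (simp add: mult_ac)
  qed
  have "frame_family sT ipT (I \<times> J) ?X ?u (B1 * B2) (A1 * A2)"
  proof
    show "0 < A1 * A2" using V.lower_pos W.lower_pos by simp
    fix x
    have inner: "(\<Sum>\<^sub>\<infinity>j\<in>J. ?q x (i, j)) = (v i)\<^sup>2 * (\<Sum>\<^sub>\<infinity>j\<in>J. (w j)\<^sup>2 * (norm (W.P j (V.P i x)))\<^sup>2)"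
      if "i \<in> I" for i
      unfolding infsum_cmult_right'[symmetric] using that by (intro infsum_cong q)
    have "A1 * A2 * (norm x)\<^sup>2 \<le> A2 * (\<Sum>\<^sub>\<infinity>i\<in>I. (v i)\<^sup>2 * (norm (V.P i x))\<^sup>2)"
      using W.lower_pos V.lower[of x] by (simp add: mult.assoc mult.left_commute[of A1])
    also have "\<dots> = (\<Sum>\<^sub>\<infinity>i\<in>I. A2 * ((v i)\<^sup>2 * (norm (V.P i x))\<^sup>2))"
      by (simp add: infsum_cmult_right')
    also have "\<dots> \<le> (\<Sum>\<^sub>\<infinity>i\<in>I. \<Sum>\<^sub>\<infinity>j\<in>J. ?q x (i, j))"
    proof (rule infsum_mono)
      show "(\<lambda>i. A2 * ((v i)\<^sup>2 * (norm (V.P i x))\<^sup>2)) summable_on I"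
        by (intro summable_on_cmult_right V.bessel_summable)
      \<comment> \<open>Summability over the product, known from the Bessel bound, gives summability
        of the row sums.\<close>
      show "(\<lambda>i. \<Sum>\<^sub>\<infinity>j\<in>J. ?q x (i, j)) summable_on I"
        using VW.bessel_summable[of x]
        by (intro summable_on_Sigma_banach[of "\<lambda>i j. ?q x (i, j)"]) (simp add: split_def)
      fix i assume i: "i \<in> I"
      have "(v i)\<^sup>2 * (A2 * (norm (V.P i x))\<^sup>2) \<le> (\<Sum>\<^sub>\<infinity>j\<in>J. ?q x (i, j))"
        unfolding inner[OF i] by (intro mult_left_mono W.lower) simp
      then show "A2 * ((v i)\<^sup>2 * (norm (V.P i x))\<^sup>2) \<le> (\<Sum>\<^sub>\<infinity>j\<in>J. ?q x (i, j))"
        by (simp only: mult.left_commute)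
    qed
    also have "\<dots> = (\<Sum>\<^sub>\<infinity>n\<in>I \<times> J. ?q x n)"
      by (rule infsum_Sigma_banach[OF VW.bessel_summable])
    finally show "A1 * A2 * (norm x)\<^sup>2 \<le> (\<Sum>\<^sub>\<infinity>n\<in>I \<times> J. ?q x n)" .
  qed
  then show ?thesis by (rule that)
qed

text \<open>Uniqueness of sums makes any admissible operator agree with \<open>frame_op\<close> on
  elementary tensors; linearity, boundedness and totality then determine it.\<close>

lemma tensor_frame_operator_eq:
  assumes "frame_family sT ipT (I \<times> J) (\<lambda>(i, j). tensor_subspace sT tens (V i) (W j))
    (\<lambda>(i, j). v i * w j) B A"
  shows "tensor_frame_operator sT ipT tens I V v J W w =
    bessel_family.frame_op ipT (I \<times> J) (\<lambda>(i, j). tensor_subspace sT tens (V i) (W j)) (\<lambda>(i, j). v i * w j)"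
proof -
  interpret F: frame_family sT ipT "I \<times> J" "\<lambda>(i, j). tensor_subspace sT tens (V i) (W j)"
    "\<lambda>(i, j). v i * w j" B A by fact
  have hs: "((\<lambda>(i, j). ((v i)\<^sup>2 * (w j)\<^sup>2) *\<^sub>R
      orth_proj ipT (tensor_subspace sT tens (V i) (W j)) x) has_sum F.frame_op x) (I \<times> J)" for x
    using F.has_sum_frame_op[of x] by (simp add: split_def power_mult_distrib)
  show ?thesis
    unfolding tensor_frame_operator_def
  proof (rule the_equality)
    fix S assume S: "bounded_operator sT S \<and> bij S \<and> (\<forall>f g. ((\<lambda>(i, j). ((v i)\<^sup>2 * (w j)\<^sup>2) *\<^sub>R
        orth_proj ipT (tensor_subspace sT tens (V i) (W j)) (tens f g)) has_sum S (tens f g)) (I \<times> J))"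
    then have S': "bounded_operator sT S" by blast
    show "S = F.frame_op"
    proof (rule T.bounded_operators_eqI[OF T.bounded_operator_bounded_linear(1)[OF S']
          F.bounded_linear_frame_op _ tens_total])
      show "S x = F.frame_op x" if x: "x \<in> {tens f g |f g. True}" for x
        using x S hs has_sum_unique by blast
    qed (simp add: T.bounded_operator_bounded_linear(2)[OF S'] F.frame_op_scale)
  qed (use hs F.bounded_operator_frame_op F.bij_frame_op in blast)
qed

end

theorem mainTheorem7:
  fixes sH :: "'k::real_or_complex \<Rightarrow> 'h::banach \<Rightarrow> 'h" and ipH :: "'h \<Rightarrow> 'h \<Rightarrow> 'k"
    and sK :: "'k \<Rightarrow> 'g::banach \<Rightarrow> 'g" and ipK :: "'g \<Rightarrow> 'g \<Rightarrow> 'k"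
    and sT :: "'k \<Rightarrow> 't::banach \<Rightarrow> 't" and ipT :: "'t \<Rightarrow> 't \<Rightarrow> 'k"
    and tens :: "'h \<Rightarrow> 'g \<Rightarrow> 't"
    and I :: "'i set" and V :: "'i \<Rightarrow> 'h set" and v :: "'i \<Rightarrow> real"
    and J :: "'j set" and W :: "'j \<Rightarrow> 'g set" and w :: "'j \<Rightarrow> real"
    and S :: "'t \<Rightarrow> 't"
  assumes "hilbert_tensor_product sH ipH sK ipK sT ipT tens"
    and "separable_space (euclidean :: 'h topology)"
    and "separable_space (euclidean :: 'g topology)"
    and "fusion_frame sH ipH I V v"
    and "fusion_frame sK ipK J W w"
    and "S = tensor_frame_operator sT ipT tens I V v J W w"
  shows "(\<forall>f g. ((\<lambda>(i, j). ((v i)\<^sup>2 * (w j)\<^sup>2) *\<^sub>R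
              orth_proj ipT (inv S ` tensor_subspace sT tens (V i) (W j))
                (inv S (orth_proj ipT (tensor_subspace sT tens (V i) (W j)) (tens f g))))
            has_sum tens f g) (I \<times> J))
    \<and> tensor_fusion_frame sT ipT tens (I \<times> J)
          (\<lambda>(i, j). inv S ` tensor_subspace sT tens (V i) (W j)) (\<lambda>(i, j). v i * w j)
    \<and> tensor_alternative_dual sT ipT tens I V v J W w
          (\<lambda>(i, j). inv S ` tensor_subspace sT tens (V i) (W j)) (\<lambda>(i, j). v i * w j)"
proof -
  interpret hilbert_tensor_product sH ipH sK ipK sT ipT tens by fact
  let ?X = "\<lambda>(i, j). tensor_subspace sT tens (V i) (W j)" and ?u = "\<lambda>(i, j). v i * w j"
  let ?Y = "\<lambda>(i, j). inv S ` tensor_subspace sT tens (V i) (W j)"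
  obtain A B where "frame_family sT ipT (I \<times> J) ?X ?u B A"
    using frame_family_tensor[OF assms(4,5)] .
  then interpret F: frame_family sT ipT "I \<times> J" ?X ?u B A .
  have S: "S = F.frame_op"
    unfolding assms(6) by (rule tensor_frame_operator_eq) unfold_locales
  have Y: "?Y n = F.R ` ?X n" for n
    by (simp add: S split_beta)
  \<comment> \<open>The formula holds at every vector \<open>x\<close>; elementary tensors are a
    special case.\<close>
  have rec: "((\<lambda>(i, j). ((v i)\<^sup>2 * (w j)\<^sup>2) *\<^sub>R
      orth_proj ipT (inv S ` tensor_subspace sT tens (V i) (W j))
        (inv S (orth_proj ipT (tensor_subspace sT tens (V i) (W j)) x))) has_sum x) (I \<times> J)" for x
    using F.canonical_dual_reconstruction[of x]
    by (simp add: S split_def power_mult_distrib)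
  have pos: "closed_subspace sT (?Y n) \<and> 0 < ?u n" if "n \<in> I \<times> J" for n
    unfolding Y using that F.closed_subspace_R_image[OF F.closed_subspaces[OF that]] assms(4,5)
    by (auto simp: fusion_frame_def)
  have low: "0 < A ^ 3 / B\<^sup>2"
    using F.lower_pos F.bound_pos by simp
  have sm: "(\<lambda>n. (?u n)\<^sup>2 * (norm (orth_proj ipT (?Y n) x))\<^sup>2) summable_on I \<times> J" for x
    unfolding Y by (rule F.canonical_dual_frame)
  have lo: "A ^ 3 / B\<^sup>2 * (norm x)\<^sup>2
      \<le> (\<Sum>\<^sub>\<infinity>n\<in>I \<times> J. (?u n)\<^sup>2 * (norm (orth_proj ipT (?Y n) x))\<^sup>2)" for x
    unfolding Y by (rule F.canonical_dual_frame)
  \<comment> \<open>The maximum is needed because \<^term>\<open>A \<le> B\<close> may fail on the zero space.\<close>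
  have up: "(\<Sum>\<^sub>\<infinity>n\<in>I \<times> J. (?u n)\<^sup>2 * (norm (orth_proj ipT (?Y n) x))\<^sup>2)
      \<le> max (A ^ 3 / B\<^sup>2) (B ^ 3 / A\<^sup>2) * (norm x)\<^sup>2" for x
    using F.canonical_dual_frame(3)[of x] unfolding Y
    by (rule order_trans) (intro mult_right_mono, auto)
  have "tensor_fusion_frame sT ipT tens (I \<times> J) ?Y ?u"
    unfolding tensor_fusion_frame_def
    by (intro conjI exI[of _ "A ^ 3 / B\<^sup>2"] exI[of _ "max (A ^ 3 / B\<^sup>2) (B ^ 3 / A\<^sup>2)"] allI ballI
        pos[THEN conjunct1] pos[THEN conjunct2] low max.cobounded1 sm lo up)
  \<comment> \<open>The upper frame bound serves as Bessel bound; it is positive because it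
    dominates the positive lower bound.\<close>
  moreover from this have "tensor_fusion_bessel sT ipT tens (I \<times> J) ?Y ?u"
    unfolding tensor_fusion_frame_def tensor_fusion_bessel_def by (meson less_le_trans)
  \<comment> \<open>The dual weight is again \<open>v i * w j\<close>, so the coefficient in the
    dual formula is the product of the squared weights in \<open>rec\<close>.\<close>
  then have "tensor_alternative_dual sT ipT tens I V v J W w ?Y ?u"
    unfolding tensor_alternative_dual_def assms(6)[symmetric]
    using rec by (simp add: split_def power2_eq_square mult_ac)
  ultimately show ?thesis using rec by blast
qed

end
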